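(* Let $X$ be an irreducible continuous-time Markov process on a finite set $\mathcal{X}$ with kernel $p$, reversible with respect to the probability measure $\mu$, and let $\mathcal{R}\subset\mathcal{X}$ be such that the restricted processes $X_{\mathcal{R}}$ and $X_{\mathcal{X}\setminus\mathcal{R}}$ are irreducible. For any probability measure $\nu$ on $\mathcal{R}$, define $\pi_{\mathcal{R}}(\nu)=\mathbb{P}_\nu(\tau_{\mathcal{X}\setminus\mathcal{R}}<T^*_{\mathcal{R}})$. If $\varepsilon^*_{\mathcal{R}}<1/3$, then for all $t\ge\phi^*_{\mathcal{R}}T^*_{\mathcal{R}}$, $$(1-\pi_{\mathcal{R}}(\nu))e^{-t}\left\{e^{\phi^*_{\mathcal{R}}T^*_{\mathcal{R}}}(1-\varepsilon^*_{\mathcal{R}})\right\}\le\mathbb{P}_\nu\left(\tau_{\mathcal{X}\setminus\mathcal{R}}>\frac{t}{\phi^*_{\mathcal{R}}}\right)\le(1-\pi_{\mathcal{R}}(\nu))e^{-t}\left\{e^{\phi^*_{\mathcal{R}}T^*_{\mathcal{R}}}(1+\varepsilon^*_{\mathcal{R}})\right\}.$$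
   Context: $X$ has generator $\mathcal{L}f(x)=\sum_{y\in\mathcal{X}}p(x,y)(f(y)-f(x))$ with $p\ge0$, $\sum_yp(x,y)=1$, $\mu(x)p(x,y)=\mu(y)p(y,x)$. $\mathcal{R}$ is a nonempty proper subset with at least two elements; $\tau_{\mathcal{X}\setminus\mathcal{R}}$ is the hitting time of $\mathcal{X}\setminus\mathcal{R}$. The restricted process $X_{\mathcal{R}}$ on $\mathcal{R}$ has kernel $p_{\mathcal{R}}(x,y)=p(x,y)$ for $x\ne y$, $p_{\mathcal{R}}(x,x)=p(x,x)+\sum_{y\notin\mathcal{R}}p(x,y)$ (similarly for $\mathcal{X}\setminus\mathcal{R}$); it is reversible with respect to $\mu_{\mathcal{R}}=\mu(\cdot\mid\mathcal{R})$, with spectral gap $\gamma_{\mathcal{R}}=\min_{\mathrm{Var}_{\mu_{\mathcal{R}}}(f)\ne0}\mathcal{D}_{\mathcal{R}}(f)/\mathrm{Var}_{\mu_{\mathcal{R}}}(f)$, $\mathcal{D}_{\mathcal{R}}(f)=\frac12\sum_{x,y\in\mathcal{R}}\mu_{\mathcal{R}}(x)p_{\mathcal{R}}(x,y)(f(x)-f(y))^2$. Let $p^*_{\mathcal{R}}(x,y)=p(x,y)$, $x,y\in\mathcal{R}$; $1-\phi^*_{\mathcal{R}}$ is its spectral radius, and $\mu^*_{\mathcal{R}}$ the unique probability measure on $\mathcal{R}$ with $\mu^*_{\mathcal{R}}p^*_{\mathcal{R}}=(1-\phi^*_{\mathcal{R}})\mu^*_{\mathcal{R}}$ (quasi-stationary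 measure). Set $\varepsilon^*_{\mathcal{R}}=\phi^*_{\mathcal{R}}/\gamma_{\mathcal{R}}$, $h^*_{\mathcal{R}}(x)=\mu^*_{\mathcal{R}}(x)/\mu_{\mathcal{R}}(x)$, $\zeta^*_{\mathcal{R}}=\min_{x\in\mathcal{R}}\mu_{\mathcal{R}}(x)h^*_{\mathcal{R}}(x)^2$ and, for $\delta\in(0,1)$ and $\varepsilon^*_{\mathcal{R}}<1/3$, $$T^*_{\delta,\mathcal{R}}=\frac{1}{\gamma_{\mathcal{R}}}\left(\ln\frac{2}{\delta(1-\delta)\zeta^*_{\mathcal{R}}}\right)\left(1+\sqrt{\frac{\varepsilon^*_{\mathcal{R}}}{1-\varepsilon^*_{\mathcal{R}}}}\right)\left(\frac{1-\varepsilon^*_{\mathcal{R}}}{1-3\varepsilon^*_{\mathcal{R}}}\right),\qquad T^*_{\mathcal{R}}=T^*_{\varepsilon^*_{\mathcal{R}},\mathcal{R}}\ (\text{i.e. }\delta=\varepsilon^*_{\mathcal{R}}).$$ *)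

theory Defs
  imports "HOL-Probability.Probability"
begin

text \<open>The state space is a finite type; a kernel is a function
  \<open>p :: 'a \<Rightarrow> 'a \<Rightarrow> real\<close>, and the reversible measure and the initial laws are
  probability mass functions.\<close>

definition stochastic_kernel :: "('a::finite \<Rightarrow> 'a \<Rightarrow> real) \<Rightarrow> bool" where
  "stochastic_kernel p \<longleftrightarrow> (\<forall>x y. 0 \<le> p x y) \<and> (\<forall>x. (\<Sum>y\<in>UNIV. p x y) = 1)"

definition reversible_wrt :: "('a::finite \<Rightarrow> 'a \<Rightarrow> real) \<Rightarrow> 'a pmf \<Rightarrow> bool" where
  "reversible_wrt p \<mu> \<longleftrightarrow> (\<forall>x y. pmf \<mu> x * p x y = pmf \<mu> y * p y x)"

text \<open>A kernel on \<open>A\<close> is irreducible if any two states of \<open>A\<close> are joined by a path in \<open>A\<close>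
  made of transitions of positive rate.\<close>

definition irreducible_on :: "'a set \<Rightarrow> ('a \<Rightarrow> 'a \<Rightarrow> real) \<Rightarrow> bool" where
  "irreducible_on A k \<longleftrightarrow>
     (\<forall>x\<in>A. \<forall>y\<in>A. (x, y) \<in> {(u, v). u \<in> A \<and> v \<in> A \<and> 0 < k u v}\<^sup>*)"

definition generator :: "('a::finite \<Rightarrow> 'a \<Rightarrow> real) \<Rightarrow> ('a \<Rightarrow> real) \<Rightarrow> 'a \<Rightarrow> real" where
  "generator p f x = (\<Sum>y\<in>UNIV. p x y * (f y - f x))"

text \<open>The transition function \<open>(exp (t L) 1\<^sub>{\<^sub>y\<^sub>}) x\<close> of the semigroup with generator \<open>L\<close>,
  given by the exponential series.\<close>

definition transition :: "('a::finite \<Rightarrow> 'a \<Rightarrow> real) \<Rightarrow> real \<Rightarrow> 'a \<Rightarrow> 'a \<Rightarrow> real" where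
  "transition p t x y = (\<Sum>n. t ^ n / fact n * (generator p ^^ n) (indicator {y}) x)"

text \<open>\<open>X\<close>, on the probability space \<open>M\<close>, is a realisation of the continuous-time Markov
  process with generator \<open>generator p\<close> and initial law \<open>\<nu>\<close>: it has right-continuous paths
  (for the discrete topology on the state space) and the finite-dimensional distributions
  prescribed by the transition function.  Thus \<open>M\<close> plays the role of \<open>P\<^sub>\<nu>\<close>.
  Only the times \<open>t \<ge> 0\<close> matter.\<close>

definition markov_process ::
  "'w measure \<Rightarrow> (real \<Rightarrow> 'w \<Rightarrow> 'a) \<Rightarrow> ('a::finite \<Rightarrow> 'a \<Rightarrow> real) \<Rightarrow> 'a pmf \<Rightarrow> bool" where
  "markov_process M X p \<nu> \<longleftrightarrow>
     prob_space M \<and>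
     (\<forall>t\<ge>0. X t \<in> measurable M (count_space UNIV)) \<and>
     (\<forall>\<omega>\<in>space M. \<forall>t\<ge>0. \<exists>e>0. \<forall>s\<in>{t..<t + e}. X s \<omega> = X t \<omega>) \<and>
     (\<forall>(n::nat) (t::nat \<Rightarrow> real) (x::nat \<Rightarrow> 'a).
        t 0 = 0 \<longrightarrow> (\<forall>i<n. t i \<le> t (Suc i)) \<longrightarrow>
        \<P>(\<omega> in M. \<forall>i\<le>n. X (t i) \<omega> = x i) =
          pmf \<nu> (x 0) * (\<Prod>i<n. transition p (t (Suc i) - t i) (x i) (x (Suc i))))"

text \<open>Extended-real valued, so that the hitting time of a set that is never reached
  is \<open>\<infinity>\<close>.\<close>

definition hitting_time :: "(real \<Rightarrow> 'w \<Rightarrow> 'a) \<Rightarrow> 'a set \<Rightarrow> 'w \<Rightarrow> ereal" where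
  "hitting_time X A \<omega> = (INF t\<in>{t. 0 \<le> t \<and> X t \<omega> \<in> A}. ereal t)"

definition restricted_kernel ::
  "'a::finite set \<Rightarrow> ('a \<Rightarrow> 'a \<Rightarrow> real) \<Rightarrow> 'a \<Rightarrow> 'a \<Rightarrow> real" where
  "restricted_kernel R p x y = (if x = y then p x x + (\<Sum>z\<in>-R. p x z) else p x y)"

text \<open>In the following, \<open>cond_pmf \<mu> R\<close> is \<open>\<mu>\<^sub>R = \<mu>(\<cdot> | R)\<close>.\<close>

definition dirichlet_form ::
  "'a::finite set \<Rightarrow> ('a \<Rightarrow> 'a \<Rightarrow> real) \<Rightarrow> 'a pmf \<Rightarrow> ('a \<Rightarrow> real) \<Rightarrow> real" where
  "dirichlet_form R p \<mu> f =
     1 / 2 * (\<Sum>x\<in>R. \<Sum>y\<in>R. pmf (cond_pmf \<mu> R) x * restricted_kernel R p x y * (f x - f y)\<^sup>2)"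

text \<open>The minimum of the Rayleigh quotient; being attained, it is the infimum.\<close>

definition spectral_gap :: "'a::finite set \<Rightarrow> ('a \<Rightarrow> 'a \<Rightarrow> real) \<Rightarrow> 'a pmf \<Rightarrow> real" where
  "spectral_gap R p \<mu> =
     Inf {dirichlet_form R p \<mu> f / measure_pmf.variance (cond_pmf \<mu> R) f | f.
            measure_pmf.variance (cond_pmf \<mu> R) f \<noteq> 0}"

text \<open>Complex spectrum and spectral radius of the square matrix \<open>(k x y)\<close>, \<open>x, y \<in> R\<close>.
  Applied to \<open>p\<close> itself, they concern the sub-Markovian kernel \<open>p\<^sup>*\<^sub>R\<close>, the restriction
  of \<open>p\<close> to \<open>R \<times> R\<close>.\<close>

definition spectrum_on :: "'a::finite set \<Rightarrow> ('a \<Rightarrow> 'a \<Rightarrow> real) \<Rightarrow> complex set" where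
  "spectrum_on R k = {c. \<exists>f :: 'a \<Rightarrow> complex. (\<exists>x\<in>R. f x \<noteq> 0) \<and>
     (\<forall>x\<in>R. (\<Sum>y\<in>R. complex_of_real (k x y) * f y) = c * f x)}"

definition spectral_radius_on :: "'a::finite set \<Rightarrow> ('a \<Rightarrow> 'a \<Rightarrow> real) \<Rightarrow> real" where
  "spectral_radius_on R k = Max (cmod ` spectrum_on R k)"

definition phi_star :: "'a::finite set \<Rightarrow> ('a \<Rightarrow> 'a \<Rightarrow> real) \<Rightarrow> real" where
  "phi_star R p = 1 - spectral_radius_on R p"

definition quasi_stationary :: "'a::finite set \<Rightarrow> ('a \<Rightarrow> 'a \<Rightarrow> real) \<Rightarrow> 'a pmf" where
  "quasi_stationary R p = (THE m. set_pmf m \<subseteq> R \<and>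
     (\<forall>y\<in>R. (\<Sum>x\<in>R. pmf m x * p x y) = (1 - phi_star R p) * pmf m y))"

definition eps_star :: "'a::finite set \<Rightarrow> ('a \<Rightarrow> 'a \<Rightarrow> real) \<Rightarrow> 'a pmf \<Rightarrow> real" where
  "eps_star R p \<mu> = phi_star R p / spectral_gap R p \<mu>"

definition h_star :: "'a::finite set \<Rightarrow> ('a \<Rightarrow> 'a \<Rightarrow> real) \<Rightarrow> 'a pmf \<Rightarrow> 'a \<Rightarrow> real" where
  "h_star R p \<mu> x = pmf (quasi_stationary R p) x / pmf (cond_pmf \<mu> R) x"

definition zeta_star :: "'a::finite set \<Rightarrow> ('a \<Rightarrow> 'a \<Rightarrow> real) \<Rightarrow> 'a pmf \<Rightarrow> real" where
  "zeta_star R p \<mu> = Min ((\<lambda>x. pmf (cond_pmf \<mu> R) x * (h_star R p \<mu> x)\<^sup>2) ` R)"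

definition T_star_delta ::
  "real \<Rightarrow> 'a::finite set \<Rightarrow> ('a \<Rightarrow> 'a \<Rightarrow> real) \<Rightarrow> 'a pmf \<Rightarrow> real" where
  "T_star_delta \<delta> R p \<mu> =
     1 / spectral_gap R p \<mu> *
     ln (2 / (\<delta> * (1 - \<delta>) * zeta_star R p \<mu>)) *
     (1 + sqrt (eps_star R p \<mu> / (1 - eps_star R p \<mu>))) *
     ((1 - eps_star R p \<mu>) / (1 - 3 * eps_star R p \<mu>))"

definition T_star :: "'a::finite set \<Rightarrow> ('a \<Rightarrow> 'a \<Rightarrow> real) \<Rightarrow> 'a pmf \<Rightarrow> real" where
  "T_star R p \<mu> = T_star_delta (eps_star R p \<mu>) R p \<mu>"

text \<open>The probability, under \<open>M = P\<^sub>\<nu>\<close>, of leaving \<open>R\<close> before time \<open>T\<^sup>*\<^sub>R\<close>.\<close>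

definition exit_prob ::
  "'w measure \<Rightarrow> (real \<Rightarrow> 'w \<Rightarrow> 'a) \<Rightarrow> 'a::finite set \<Rightarrow> ('a \<Rightarrow> 'a \<Rightarrow> real) \<Rightarrow> 'a pmf \<Rightarrow> real" where
  "exit_prob M X R p \<mu> = \<P>(\<omega> in M. hitting_time X (- R) \<omega> < ereal (T_star R p \<mu>))"

end

theory Submission
  imports Defs
begin

text \<open>Let \<open>h\<close> be the Perron eigenfunction of the kernel killed outside \<open>R\<close>, normalised by
  \<open>\<mu>\<^sub>R(h) = 1\<close>; by reversibility \<open>\<mu>\<^sup>* = h \<mu>\<^sub>R\<close>, so \<open>h = h\<^sup>*\<close>.
  The survival function \<open>u\<^sub>t = exp (t L\<^sup>*) 1\<close> of the killed semigroup splits as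
  \<open>u\<^sub>t = exp (- \<phi> t) h / \<mu>\<^sub>R(h\<^sup>2) + g\<^sub>t\<close>, where \<open>g\<^sub>t\<close> stays orthogonal to \<open>h\<close>.
  As \<open>h\<close> is almost constant, functions orthogonal to \<open>h\<close> are almost centred, and the Poincare
  inequality of the restricted chain makes \<open>g\<^sub>t\<close> decay at rate \<open>\<gamma> (1 - \<epsilon>)\<close>.  Hence at all times
  \<open>t \<ge> T\<close> the function \<open>exp (\<phi> t) u\<^sub>t\<close> is within a factor \<open>1 \<plusminus> \<epsilon> / 3\<close> of
  \<open>h / \<mu>\<^sub>R(h\<^sup>2)\<close>, pointwise, and comparing the times \<open>T\<close> and \<open>t\<close> gives the theorem.
  The law of the exit time is obtained from the finite-dimensional distributions
  along dyadic grids.\<close>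

section \<open>The semigroup of a kernel\<close>

text \<open>Both constants have one source. Write w for \<mu> conditioned on R, and B for the w-mean
  of h^2. The gap inequality tested on h reads \<gamma> (B - 1) <= \<phi> B, that is 1 - 1/B <=
  \<epsilon>. This number bounds the squared norm of g_0 as well as the squared mean of any unit
  function orthogonal to h. As the initial law is arbitrary, a norm bound on g_t is not enough.
  Passing to a point x loses the factor 1 / w x, and measured relative to h x this is 1 / (w x (h
  x)^2) <= 1 / \<zeta>: hence the \<zeta> inside the logarithm of T. The obstacle on the
  probabilistic side is that finite-dimensional distributions describe the free process, which may
  leave R and return between two grid times. This costs an error quadratic in the step, so it
  disappears when the grid is refined. States outside R are made absorbing rather than removed, so
  that one theory of semigroups of stochastic kernels serves the free and the killed process
  alike.\<close>

text \<open>\<open>transition\<close> is the case of an indicator. General functions are needed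
  because grid steps act on survival functions and the splitting along \<open>h\<close> produces
  real-valued ones.\<close>

definition heat :: "('a::finite \<Rightarrow> 'a \<Rightarrow> real) \<Rightarrow> real \<Rightarrow> ('a \<Rightarrow> real) \<Rightarrow> 'a \<Rightarrow> real" where
  "heat p t f x = (\<Sum>n. t ^ n / fact n * (generator p ^^ n) f x)"

lemma transition_eq_heat: "transition p t x y = heat p t (indicator {y}) x"
  by (simp add: transition_def heat_def)

lemma generator_sum:
  "generator p (\<lambda>x. \<Sum>i\<in>I. c i * f i x) = (\<lambda>x. \<Sum>i\<in>I. c i * generator p (f i) x)"
proof
  fix x
  have "generator p (\<lambda>x. \<Sum>i\<in>I. c i * f i x) x
      = (\<Sum>y\<in>UNIV. \<Sum>i\<in>I. c i * (p x y * (f i y - f i x)))"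
    unfolding generator_def
    by (intro sum.cong refl) (simp add: sum_distrib_left algebra_simps flip: sum_subtractf)
  also have "\<dots> = (\<Sum>i\<in>I. c i * generator p (f i) x)"
    unfolding generator_def by (subst sum.swap) (simp add: sum_distrib_left)
  finally show "generator p (\<lambda>x. \<Sum>i\<in>I. c i * f i x) x = (\<Sum>i\<in>I. c i * generator p (f i) x)" .
qed

lemma generator_pow_sum:
  "(generator p ^^ n) (\<lambda>x. \<Sum>i\<in>I. c i * f i x) = (\<lambda>x. \<Sum>i\<in>I. c i * (generator p ^^ n) (f i) x)"
  by (induction n) (simp_all add: generator_sum)

lemma generator_bound:
  assumes p: "stochastic_kernel p" and f: "\<forall>x. \<bar>f x\<bar> \<le> B"
  shows "\<bar>generator p f x\<bar> \<le> 2 * B"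
proof -
  have "\<bar>generator p f x\<bar> \<le> (\<Sum>y\<in>UNIV. p x y * (2 * B))"
    unfolding generator_def
  proof (rule order_trans[OF sum_abs], rule sum_mono)
    fix y
    have "\<bar>f y - f x\<bar> \<le> 2 * B" using f[rule_format, of x] f[rule_format, of y] by linarith
    then show "\<bar>p x y * (f y - f x)\<bar> \<le> p x y * (2 * B)"
      using p by (auto simp: abs_mult stochastic_kernel_def intro!: mult_left_mono)
  qed
  also have "\<dots> = 2 * B"
    using p by (simp add: stochastic_kernel_def flip: sum_distrib_right)
  finally show ?thesis .
qed

lemma generator_pow_bound:
  assumes p: "stochastic_kernel p" and f: "\<forall>x. \<bar>f x\<bar> \<le> B"
  shows "\<bar>(generator p ^^ n) f x\<bar> \<le> 2 ^ n * B"
proof (induction n arbitrary: x)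
  case (Suc n)
  then show ?case using generator_bound[OF p, of "(generator p ^^ n) f" "2 ^ n * B" x] by simp
qed (use f in simp)

lemma exists_bound: "\<exists>B\<ge>0. \<forall>x. \<bar>f x :: real\<bar> \<le> B" for f :: "'a::finite \<Rightarrow> real"
  by (rule exI[of _ "\<Sum>x\<in>UNIV. \<bar>f x\<bar>"]) (auto intro!: sum_nonneg member_le_sum)

lemma heat_term_bound:
  assumes p: "stochastic_kernel p" and f: "\<forall>x. \<bar>f x\<bar> \<le> B"
  shows "\<bar>t ^ n / fact n * (generator p ^^ n) f x\<bar> \<le> B * ((2 * \<bar>t\<bar>) ^ n / fact n)"
proof -
  have "\<bar>t ^ n / fact n * (generator p ^^ n) f x\<bar> \<le> \<bar>t\<bar> ^ n / fact n * (2 ^ n * B)"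
    unfolding abs_mult abs_divide power_abs
    by (intro mult_mono generator_pow_bound[OF p f]) auto
  then show ?thesis by (simp add: power_mult_distrib mult_ac)
qed

lemma summable_exp_real: "summable (\<lambda>n. (x::real) ^ n / fact n)"
  using summable_exp[of x] by (simp add: field_simps)

lemma suminf_exp_real: "(\<Sum>n. (x::real) ^ n / fact n) = exp x"
  by (simp add: exp_def divide_inverse mult.commute)

lemma heat_summable:
  assumes p: "stochastic_kernel p"
  shows "summable (\<lambda>n. t ^ n / fact n * (generator p ^^ n) f x)"
proof -
  obtain B where B: "\<forall>x. \<bar>f x\<bar> \<le> B" using exists_bound[of f] by blast
  show ?thesis
  proof (rule summable_comparison_test')
    show "summable (\<lambda>n. B * ((2 * \<bar>t\<bar>) ^ n / fact n))"
      by (intro summable_mult summable_exp_real)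
  qed (use heat_term_bound[OF p, of f B] B in auto)
qed

lemma heat_sum:
  assumes p: "stochastic_kernel p"
  shows "heat p t (\<lambda>x. \<Sum>i\<in>I. c i * f i x) x = (\<Sum>i\<in>I. c i * heat p t (f i) x)"
proof -
  have "heat p t (\<lambda>x. \<Sum>i\<in>I. c i * f i x) x
      = (\<Sum>n. \<Sum>i\<in>I. c i * (t ^ n / fact n * (generator p ^^ n) (f i) x))"
    unfolding heat_def generator_pow_sum
    by (simp add: sum_distrib_left mult_ac)
  also have "\<dots> = (\<Sum>i\<in>I. \<Sum>n. c i * (t ^ n / fact n * (generator p ^^ n) (f i) x))"
    by (intro suminf_sum summable_mult heat_summable[OF p])
  also have "\<dots> = (\<Sum>i\<in>I. c i * heat p t (f i) x)"
    unfolding heat_def by (intro sum.cong refl suminf_mult heat_summable[OF p])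
  finally show ?thesis .
qed

lemma heat_lincomb:
  assumes p: "stochastic_kernel p"
  shows "heat p t (\<lambda>x. a * f x + b * g x) x = a * heat p t f x + b * heat p t g x"
  using heat_sum[OF p, where t = t and x = x and I = "UNIV :: bool set"
      and c = "\<lambda>i. if i then a else b" and f = "\<lambda>i. if i then f else g"]
  by (simp add: UNIV_bool add.commute)

lemma heat_eq_transition:
  assumes p: "stochastic_kernel p"
  shows "heat p t f x = (\<Sum>y\<in>UNIV. transition p t x y * f y)"
proof -
  have "f = (\<lambda>x. \<Sum>y\<in>UNIV. f y * indicator {y} x)"
    by (auto simp: indicator_def if_distrib sum.delta cong: if_cong)
  then have "heat p t f x = heat p t (\<lambda>x. \<Sum>y\<in>UNIV. f y * indicator {y} x) x" by simp
  then show ?thesis unfolding heat_sum[OF p] transition_eq_heat by (simp add: mult.commute)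
qed

lemma heat_0: "heat p 0 f = f"
proof
  fix x
  have "heat p 0 f x = (\<Sum>n\<in>{0}. 0 ^ n / fact n * (generator p ^^ n) f x)"
    unfolding heat_def by (rule suminf_finite) auto
  then show "heat p 0 f x = f x" by simp
qed

lemma heat_bound:
  assumes p: "stochastic_kernel p" and f: "\<forall>x. \<bar>f x\<bar> \<le> B"
  shows "\<bar>heat p t f x\<bar> \<le> B * exp (2 * \<bar>t\<bar>)"
proof -
  have s: "summable (\<lambda>n. B * ((2 * \<bar>t\<bar>) ^ n / fact n))"
    by (intro summable_mult summable_exp_real)
  have "norm (heat p t f x) \<le> (\<Sum>n. B * ((2 * \<bar>t\<bar>) ^ n / fact n))"
    unfolding heat_def
    by (rule norm_suminf_le[OF _ s]) (use heat_term_bound[OF p f] in \<open>simp only: real_norm_def\<close>)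
  also have "\<dots> = B * exp (2 * \<bar>t\<bar>)"
    by (simp only: suminf_mult[OF summable_exp_real] suminf_exp_real)
  finally show ?thesis by simp
qed

lemma heat_generator:
  assumes p: "stochastic_kernel p"
  shows "heat p t (generator p f) x = generator p (heat p t f) x"
proof -
  let ?a = "\<lambda>z n. t ^ n / fact n * (generator p ^^ n) f z"
  note s = heat_summable[OF p, of t f]
  have "generator p (heat p t f) x = (\<Sum>y\<in>UNIV. p x y * ((\<Sum>n. ?a y n) - (\<Sum>n. ?a x n)))"
    unfolding generator_def heat_def ..
  also have "\<dots> = (\<Sum>y\<in>UNIV. \<Sum>n. p x y * (?a y n - ?a x n))"
    by (intro sum.cong refl) (simp only: suminf_diff[OF s s] suminf_mult[OF summable_diff[OF s s]])
  also have "\<dots> = (\<Sum>n. \<Sum>y\<in>UNIV. p x y * (?a y n - ?a x n))"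
    by (rule suminf_sum[symmetric]) (intro summable_mult summable_diff s)
  also have "\<dots> = heat p t (generator p f) x"
    unfolding heat_def funpow_swap1[symmetric]
    by (simp add: generator_def[of p "(generator p ^^ _) f"] sum_distrib_left algebra_simps)
  finally show ?thesis by simp
qed

lemma heat_DERIV_generator:
  assumes p: "stochastic_kernel p"
  shows "((\<lambda>t. heat p t f x) has_real_derivative heat p t (generator p f) x) (at t)"
proof -
  let ?c = "\<lambda>n. (generator p ^^ n) f x / fact n"
  have s: "summable (\<lambda>n. ?c n * y ^ n)" for y
    using heat_summable[OF p, of y f x] by (simp add: mult.commute)
  have d: "diffs ?c n * t ^ n = t ^ n / fact n * (generator p ^^ n) (generator p f) x" for n
    by (simp add: diffs_def funpow_swap1 del: of_nat_Suc) 
  have "(\<lambda>t. \<Sum>n. ?c n * t ^ n) = (\<lambda>t. heat p t f x)"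
    by (simp add: heat_def mult.commute)
  then show ?thesis
    using termdiffs_strong_converges_everywhere[OF s, of t] by (simp only: d heat_def)
qed

lemma heat_DERIV:
  assumes p: "stochastic_kernel p"
  shows "((\<lambda>t. heat p t f x) has_real_derivative generator p (heat p t f) x) (at t)"
  using heat_DERIV_generator[OF p] heat_generator[OF p] by simp

text \<open>Two applications of the mean value theorem leave the second derivative, which is the
  semigroup applied to the twice iterated generator. The factor 4 is there because the generator at
  most doubles sup norms; \<open>S\<close> makes the constant uniform on a time interval.\<close>

lemma heat_taylor:
  assumes p: "stochastic_kernel p" and f: "\<forall>x. \<bar>f x\<bar> \<le> B" and "0 \<le> s" "0 \<le> h" "s + h \<le> S"
  shows "\<bar>heat p (s + h) f x - heat p s f x - h * generator p (heat p s f) x\<bar>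
    \<le> 4 * B * exp (2 * S) * h\<^sup>2"
proof (cases "h = 0")
  case False
  then have h: "h > 0" using assms by simp
  let ?u = "\<lambda>g t. heat p t g x" and ?G = "generator p"
  obtain z where z: "s < z" "z < s + h" "?u f (s + h) - ?u f s = (s + h - s) * ?u (?G f) z"
    using MVT2[of s "s + h" "?u f" "?u (?G f)"] heat_DERIV_generator[OF p] h by auto
  obtain y where y: "s < y" "y < z" "?u (?G f) z - ?u (?G f) s = (z - s) * ?u (?G (?G f)) y"
    using MVT2[of s z "?u (?G f)" "?u (?G (?G f))"] heat_DERIV_generator[OF p] z by auto
  have "\<forall>x. \<bar>?G (?G f) x\<bar> \<le> 4 * B"
    using generator_pow_bound[OF p f, where n = 2] by (simp add: numeral_2_eq_2)
  from heat_bound[OF p this, where t = y and x = x]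
  have K: "\<bar>?u (?G (?G f)) y\<bar> \<le> 4 * B * exp (2 * y)" using y assms by simp
  also have "\<dots> \<le> 4 * B * exp (2 * S)"
    using f[rule_format, of x] y z assms by (intro mult_left_mono) auto
  finally have K: "\<bar>?u (?G (?G f)) y\<bar> \<le> 4 * B * exp (2 * S)" .
  have "?u f (s + h) - ?u f s - h * ?u (?G f) s = h * (?u (?G f) z - ?u (?G f) s)"
    using z(3) by (simp add: algebra_simps)
  also have "\<dots> = h * ((z - s) * ?u (?G (?G f)) y)"
    unfolding y(3) ..
  finally have "?u f (s + h) - ?u f s - h * ?u (?G f) s = h * ((z - s) * ?u (?G (?G f)) y)" .
  then have "\<bar>?u f (s + h) - ?u f s - h * ?u (?G f) s\<bar> = h * (z - s) * \<bar>?u (?G (?G f)) y\<bar>"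
    using h z by (simp add: abs_mult)
  also have "\<dots> \<le> h * h * (4 * B * exp (2 * S))"
    using h z K by (intro mult_mono) auto
  finally show ?thesis by (simp add: heat_generator[OF p] power2_eq_square mult_ac)
qed simp

section \<open>The law of the exit time\<close>

text \<open>States outside \<open>R\<close> become absorbing. The kernel stays stochastic, and on
  functions vanishing outside \<open>R\<close> its semigroup is the killed one.\<close>

definition stopped_kernel :: "'a set \<Rightarrow> ('a \<Rightarrow> 'a \<Rightarrow> real) \<Rightarrow> 'a \<Rightarrow> 'a \<Rightarrow> real" where
  "stopped_kernel R p x y = (if x \<in> R then p x y else if x = y then 1 else 0)"

lemma stochastic_stopped_kernel:
  assumes "stochastic_kernel p"
  shows "stochastic_kernel (stopped_kernel R p)"
  unfolding stochastic_kernel_def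
proof safe
  fix x show "(\<Sum>y\<in>UNIV. stopped_kernel R p x y) = 1"
    by (cases "x \<in> R") (use assms in \<open>auto simp: stochastic_kernel_def stopped_kernel_def\<close>)
qed (use assms in \<open>auto simp: stochastic_kernel_def stopped_kernel_def\<close>)

lemma generator_stopped:
  "generator (stopped_kernel R p) f x = (if x \<in> R then generator p f x else 0)"
  by (auto simp: generator_def stopped_kernel_def intro!: sum.neutral)

lemma heat_stopped_outside:
  assumes "x \<notin> R"
  shows "heat (stopped_kernel R p) t f x = f x"
proof -
  have "heat (stopped_kernel R p) t f x
      = (\<Sum>n\<in>{0}. t ^ n / fact n * (generator (stopped_kernel R p) ^^ n) f x)"
    unfolding heat_def
  proof (rule suminf_finite)
    fix n :: nat assume "n \<notin> {0}"
    then obtain m where "n = Suc m" by (cases n) auto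
    then show "t ^ n / fact n * (generator (stopped_kernel R p) ^^ n) f x = 0"
      using assms by (simp add: generator_stopped)
  qed simp
  then show ?thesis by simp
qed

section \<open>Grid approximation of the killed semigroup\<close>

definition survival :: "'a set \<Rightarrow> ('a::finite \<Rightarrow> 'a \<Rightarrow> real) \<Rightarrow> real \<Rightarrow> 'a \<Rightarrow> real" where
  "survival R p t = heat (stopped_kernel R p) t (indicator R)"

text \<open>A step of \<open>q\<close> that has to end in \<open>R\<close>. Its powers on
  \<open>indicator R\<close> give the probabilities of being in \<open>R\<close> at all times of a
  grid.\<close>

definition kernel_op :: "'a set \<Rightarrow> ('a \<Rightarrow> 'a \<Rightarrow> real) \<Rightarrow> ('a \<Rightarrow> real) \<Rightarrow> 'a \<Rightarrow> real" where
  "kernel_op R q f x = (\<Sum>y\<in>R. q x y * f y)"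

lemma kernel_op_transition:
  fixes p :: "'a::finite \<Rightarrow> 'a \<Rightarrow> real"
  assumes "stochastic_kernel p"
  shows "kernel_op R (transition p h) f x = heat p h (\<lambda>y. indicator R y * f y) x"
proof -
  have "(\<Sum>y\<in>UNIV. transition p h x y * (indicator R y * f y))
      = (\<Sum>y\<in>UNIV. if y \<in> R then transition p h x y * f y else 0)"
    by (intro sum.cong) (auto simp: indicator_def)
  then show ?thesis
    unfolding heat_eq_transition[OF assms] kernel_op_def by (simp add: sum.If_cases)
qed

lemma survival_bound:
  fixes p :: "'a::finite \<Rightarrow> 'a \<Rightarrow> real"
  assumes "stochastic_kernel p" "0 \<le> s"
  shows "\<bar>survival R p s x\<bar> \<le> exp (2 * s)"
proof -
  have "\<forall>x::'a. \<bar>indicator R x :: real\<bar> \<le> 1" by (simp split: split_indicator)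
  from heat_bound[OF stochastic_stopped_kernel[OF assms(1)] this, of R s x] assms(2)
  show ?thesis by (simp add: survival_def)
qed

text \<open>At points of \<open>R\<close> the free and the stopped generator agree, so both terms
  have the same first-order expansion in \<open>h\<close>. The two remainders are at most
  \<open>4 * exp (4 * S) * h\<^sup>2\<close> each.\<close>

lemma survival_local_error:
  fixes p :: "'a::finite \<Rightarrow> 'a \<Rightarrow> real"
  assumes p: "stochastic_kernel p" and x: "x \<in> R" and s: "0 \<le> s" "0 \<le> h" "s + h \<le> S"
  shows "\<bar>kernel_op R (transition p h) (survival R p s) x - survival R p (s + h) x\<bar>
    \<le> 8 * exp (4 * S) * h\<^sup>2"
proof -
  let ?u = "survival R p"
  have "(\<lambda>y. indicator R y * ?u s y) = ?u s"
    by (auto simp: survival_def heat_stopped_outside split: split_indicator)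
  then have K: "kernel_op R (transition p h) (?u s) x = heat p h (?u s) x"
    by (simp add: kernel_op_transition[OF p])
  have "\<forall>x. \<bar>?u s x\<bar> \<le> exp (2 * S)"
    using s by (auto intro!: order_trans[OF survival_bound[OF p s(1), of R]])
  from heat_taylor[OF p this, of 0 h S x]
  have 1: "\<bar>heat p h (?u s) x - ?u s x - h * generator p (?u s) x\<bar> \<le> 4 * exp (2 * S) * exp (2 * S) * h\<^sup>2"
    using s by (simp add: heat_0)
  have ind: "\<forall>x::'a. \<bar>indicator R x :: real\<bar> \<le> 1" by (simp split: split_indicator)
  have 2: "\<bar>?u (s + h) x - ?u s x - h * generator p (?u s) x\<bar> \<le> 4 * exp (2 * S) * h\<^sup>2"
    using heat_taylor[OF stochastic_stopped_kernel[OF p] ind s, of R x] x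
    by (simp add: survival_def generator_stopped)
  have 3: "4 * exp (2 * S) * h\<^sup>2 \<le> 4 * exp (4 * S) * h\<^sup>2"
    using s by (intro mult_right_mono) auto
  have "4 * exp (2 * S) * exp (2 * S) * h\<^sup>2 = 4 * exp (4 * S) * h\<^sup>2"
    by (simp flip: exp_add)
  with 1 2 3 K show ?thesis by linarith
qed

text \<open>Local errors add up, and a step magnifies an earlier error by at most
  \<open>exp (2 * h)\<close>. The bound is crude, but \<open>n * h\<^sup>2\<close> tends to 0 when
  \<open>n * h\<close> is fixed.\<close>

lemma survival_global_error:
  fixes p :: "'a::finite \<Rightarrow> 'a \<Rightarrow> real"
  assumes p: "stochastic_kernel p" and h: "0 \<le> h" and n: "real n * h \<le> S"
  shows "\<forall>x\<in>R. \<bar>(kernel_op R (transition p h) ^^ n) (indicator R) x - survival R p (real n * h) x\<bar>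
    \<le> real n * (8 * exp (4 * S) * h\<^sup>2) * exp (2 * (real n * h))"
  using n
proof (induction n)
  case 0
  show ?case by (simp add: survival_def heat_0)
next
  case (Suc n)
  let ?K = "kernel_op R (transition p h)"
  let ?s = "real n * h" and ?C = "8 * exp (4 * S) * h\<^sup>2"
  \<comment> \<open>The induction hypothesis controls the error on \<open>R\<close> only. Cutting it
    off outside \<open>R\<close> gives a globally bounded function to which
    \<open>heat_bound\<close> applies, and \<open>kernel_op\<close> does not see the
    difference.\<close>
  let ?e = "\<lambda>x. indicator R x * ((?K ^^ n) (indicator R) x - survival R p ?s x)"
  have S: "?s + h \<le> S" using Suc.prems by (simp add: algebra_simps)
  then have "?s \<le> S" using h by linarith
  from Suc.IH[OF this]
  have e: "\<forall>x. \<bar>?e x\<bar> \<le> real n * ?C * exp (2 * ?s)"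
    using h by (auto split: split_indicator)
  show ?case
  proof
    fix x assume x: "x \<in> R"
    have "(?K ^^ Suc n) (indicator R) x - ?K (survival R p ?s) x = heat p h ?e x"
      unfolding kernel_op_transition[OF p, symmetric]
      by (simp add: kernel_op_def sum_subtractf algebra_simps)
    moreover have "\<bar>heat p h ?e x\<bar> \<le> real n * ?C * exp (2 * ?s) * exp (2 * \<bar>h\<bar>)"
      by (rule heat_bound[OF p e])
    moreover have "\<bar>?K (survival R p ?s) x - survival R p (?s + h) x\<bar> \<le> ?C"
      using survival_local_error[OF p x _ h S] h by simp
    moreover have "?C * 1 \<le> ?C * exp (2 * (?s + h))"
      using h by (intro mult_left_mono) auto
    moreover have "real n * ?C * exp (2 * ?s) * exp (2 * \<bar>h\<bar>) = real n * ?C * exp (2 * (?s + h))"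
      using h by (simp add: algebra_simps flip: exp_add)
    moreover have "real (Suc n) * h = ?s + h" "real (Suc n) * ?C * exp (2 * (?s + h))
        = real n * ?C * exp (2 * (?s + h)) + ?C * exp (2 * (?s + h))"
      by (simp_all add: algebra_simps)
    ultimately show "\<bar>(?K ^^ Suc n) (indicator R) x - survival R p (real (Suc n) * h) x\<bar>
        \<le> real (Suc n) * ?C * exp (2 * (real (Suc n) * h))"
      by (simp only:)
  qed
qed

text \<open>With \<open>n\<close> steps of length \<open>s / n\<close> the global error is of order
  \<open>1 / n\<close>.\<close>

lemma survival_limit:
  fixes p :: "'a::finite \<Rightarrow> 'a \<Rightarrow> real"
  assumes p: "stochastic_kernel p" and s: "0 \<le> s" and x: "x \<in> R"
  shows "(\<lambda>N. (kernel_op R (transition p (s / real (Suc N))) ^^ Suc N) (indicator R) x)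
    \<longlonglongrightarrow> survival R p s x"
proof -
  let ?C = "8 * exp (4 * s) * s\<^sup>2 * exp (2 * s)"
  have "(\<lambda>N. (kernel_op R (transition p (s / real (Suc N))) ^^ Suc N) (indicator R) x - survival R p s x)
    \<longlonglongrightarrow> 0"
  proof (rule Lim_null_comparison)
    show "\<forall>\<^sub>F N in sequentially.
      norm ((kernel_op R (transition p (s / real (Suc N))) ^^ Suc N) (indicator R) x - survival R p s x)
        \<le> ?C * inverse (real (Suc N))"
    proof (rule always_eventually, rule allI)
      fix N
      have N: "real (Suc N) * (s / real (Suc N)) = s" by (simp del: of_nat_Suc)
      have "real (Suc N) * (8 * exp (4 * s) * (s / real (Suc N))\<^sup>2) * exp (2 * s)
         = ?C * inverse (real (Suc N))"
        by (simp add: power2_eq_square field_simps del: of_nat_Suc)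
      moreover have "\<bar>(kernel_op R (transition p (s / real (Suc N))) ^^ Suc N) (indicator R) x - survival R p s x\<bar>
          \<le> real (Suc N) * (8 * exp (4 * s) * (s / real (Suc N))\<^sup>2) * exp (2 * s)"
        using survival_global_error[OF p, of "s / real (Suc N)" "Suc N" s R] x s unfolding N by simp
      ultimately show "norm ((kernel_op R (transition p (s / real (Suc N))) ^^ Suc N) (indicator R) x
          - survival R p s x) \<le> ?C * inverse (real (Suc N))"
        by (simp only: real_norm_def)
    qed
    show "(\<lambda>N. ?C * inverse (real (Suc N))) \<longlonglongrightarrow> 0"
      using tendsto_mult_right_zero[OF LIMSEQ_inverse_real_of_nat] by blast
  qed
  then show ?thesis by (rule LIM_zero_cancel)
qed

section \<open>Finite-dimensional distributions on a grid\<close>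

lemma sum_PiE_insert:
  assumes "finite S" "x \<notin> S" "\<And>i. i \<in> insert x S \<Longrightarrow> finite (T i)"
  shows "(\<Sum>f\<in>Pi\<^sub>E (insert x S) T. F f) = (\<Sum>f\<in>Pi\<^sub>E S T. \<Sum>y\<in>T x. F (f(x := y)))"
proof -
  have "(\<Sum>f\<in>Pi\<^sub>E (insert x S) T. F f) = (\<Sum>(y, f)\<in>T x \<times> Pi\<^sub>E S T. F (f(x := y)))"
    unfolding PiE_insert_eq using inj_combinator[OF assms(2), of T]
    by (subst sum.reindex) (auto simp: case_prod_beta comp_def)
  also have "\<dots> = (\<Sum>f\<in>Pi\<^sub>E S T. \<Sum>y\<in>T x. F (f(x := y)))"
    by (subst sum.cartesian_product[symmetric], subst sum.swap) simp
  finally show ?thesis .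
qed

text \<open>The induction removes the last step of the path and absorbs it into the terminal
  function, which is why \<open>g\<close> is arbitrary.\<close>

lemma sum_paths:
  fixes q :: "'a::finite \<Rightarrow> 'a \<Rightarrow> real"
  shows "(\<Sum>x\<in>{..n} \<rightarrow>\<^sub>E R. a (x 0) * (\<Prod>i<n. q (x i) (x (Suc i))) * g (x n))
    = (\<Sum>x\<in>R. a x * (kernel_op R q ^^ n) g x)"
proof (induction n arbitrary: g)
  case 0
  have "{..0::nat} = insert 0 {}" by auto
  then show ?case by (simp add: sum_PiE_insert del: insert_iff)
next
  case (Suc n)
  have "(\<Sum>x\<in>{..Suc n} \<rightarrow>\<^sub>E R. a (x 0) * (\<Prod>i<Suc n. q (x i) (x (Suc i))) * g (x (Suc n)))
    = (\<Sum>x\<in>{..n} \<rightarrow>\<^sub>E R. \<Sum>y\<in>R. a (x 0) * (\<Prod>i<n. q (x i) (x (Suc i))) * (q (x n) y * g y))"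
    unfolding atMost_Suc by (subst sum_PiE_insert) (auto simp: mult_ac intro!: sum.cong)
  also have "\<dots> = (\<Sum>x\<in>{..n} \<rightarrow>\<^sub>E R. a (x 0) * (\<Prod>i<n. q (x i) (x (Suc i))) * kernel_op R q g (x n))"
    by (simp add: kernel_op_def sum_distrib_left)
  finally show ?case unfolding Suc by (simp add: funpow_swap1)
qed

text \<open>The event is the disjoint union of cylinders over the grid paths inside
  \<open>R\<close>. Taking paths extensional makes them finite in number and determined by their
  values on the grid.\<close>

lemma markov_process_grid:
  fixes p :: "'a::finite \<Rightarrow> 'a \<Rightarrow> real"
  assumes X: "markov_process M X p \<nu>" and h: "0 \<le> h"
  shows "{\<omega>\<in>space M. \<forall>i\<le>n. X (real i * h) \<omega> \<in> R} \<in> sets M"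
    and "\<P>(\<omega> in M. \<forall>i\<le>n. X (real i * h) \<omega> \<in> R)
      = (\<Sum>x\<in>R. pmf \<nu> x * (kernel_op R (transition p h) ^^ n) (indicator R) x)"
proof -
  interpret prob_space M using X by (simp add: markov_process_def)
  have [measurable]: "X (real i * h) \<in> measurable M (count_space UNIV)" for i
    using X h by (simp add: markov_process_def)
  show "{\<omega>\<in>space M. \<forall>i\<le>n. X (real i * h) \<omega> \<in> R} \<in> sets M" by measurable
  let ?A = "\<lambda>x. {\<omega>\<in>space M. \<forall>i\<le>n. X (real i * h) \<omega> = x i}"
  have "{\<omega>\<in>space M. \<forall>i\<le>n. X (real i * h) \<omega> \<in> R} = (\<Union>x\<in>{..n} \<rightarrow>\<^sub>E R. ?A x)"
  proof (intro set_eqI iffI)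
    fix \<omega> assume "\<omega> \<in> {\<omega>\<in>space M. \<forall>i\<le>n. X (real i * h) \<omega> \<in> R}"
    then show "\<omega> \<in> (\<Union>x\<in>{..n} \<rightarrow>\<^sub>E R. ?A x)"
      by (intro UN_I[of "restrict (\<lambda>i. X (real i * h) \<omega>) {..n}"]) auto
  qed (auto simp: PiE_iff)
  then have "\<P>(\<omega> in M. \<forall>i\<le>n. X (real i * h) \<omega> \<in> R) = measure M (\<Union>x\<in>{..n} \<rightarrow>\<^sub>E R. ?A x)"
    by simp
  also have "\<dots> = (\<Sum>x\<in>{..n} \<rightarrow>\<^sub>E R. measure M (?A x))"
  proof (rule finite_measure_finite_Union)
    show "finite ({..n} \<rightarrow>\<^sub>E R)" by (intro finite_PiE) auto
    show "?A ` ({..n} \<rightarrow>\<^sub>E R) \<subseteq> sets M" by auto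
    show "disjoint_family_on ?A ({..n} \<rightarrow>\<^sub>E R)"
      unfolding disjoint_family_on_def
    proof (intro ballI impI)
      fix x y assume xy: "x \<in> {..n} \<rightarrow>\<^sub>E R" "y \<in> {..n} \<rightarrow>\<^sub>E R" "x \<noteq> y"
      then obtain i where "i \<le> n" "x i \<noteq> y i" by (meson PiE_ext atMost_iff)
      then show "?A x \<inter> ?A y = {}" by auto
    qed
  qed
  also have "\<dots> = (\<Sum>x\<in>{..n} \<rightarrow>\<^sub>E R.
      pmf \<nu> (x 0) * (\<Prod>i<n. transition p h (x i) (x (Suc i))) * indicator R (x n))"
  proof (rule sum.cong[OF refl])
    fix x assume x: "x \<in> {..n} \<rightarrow>\<^sub>E R"
    have "measure M (?A x) = pmf \<nu> (x 0) *
       (\<Prod>i<n. transition p (real (Suc i) * h - real i * h) (x i) (x (Suc i)))"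
      using X[unfolded markov_process_def, THEN conjunct2, THEN conjunct2, THEN conjunct2,
          rule_format, of "\<lambda>i. real i * h" n x] h
      by (simp add: mult_right_mono del: of_nat_Suc)
    moreover have "real (Suc i) * h - real i * h = h" for i by (simp add: algebra_simps)
    moreover have "x n \<in> R" using x by auto
    ultimately show "measure M (?A x) =
      pmf \<nu> (x 0) * (\<Prod>i<n. transition p h (x i) (x (Suc i))) * indicator R (x n)" by simp
  qed
  also have "\<dots> = (\<Sum>x\<in>R. pmf \<nu> x * (kernel_op R (transition p h) ^^ n) (indicator R) x)"
    by (rule sum_paths)
  finally show "\<P>(\<omega> in M. \<forall>i\<le>n. X (real i * h) \<omega> \<in> R)
      = (\<Sum>x\<in>R. pmf \<nu> x * (kernel_op R (transition p h) ^^ n) (indicator R) x)" .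
qed

section \<open>From dyadic grids to the exit time\<close>

lemma stays_iff_dyadic:
  assumes X: "\<forall>t\<ge>0. \<exists>e>0. \<forall>r\<in>{t..<t + e}. X r \<omega> = X t \<omega>" and s: "0 \<le> s"
  shows "(\<forall>r\<in>{0..s}. X r \<omega> \<in> R) \<longleftrightarrow> (\<forall>n. \<forall>i\<le>2 ^ n. X (real i * (s / 2 ^ n)) \<omega> \<in> R)"
proof (intro iffI ballI allI impI)
  fix n i :: nat assume a: "\<forall>r\<in>{0..s}. X r \<omega> \<in> R" and i: "i \<le> 2 ^ n"
  have "real i \<le> 2 ^ n" using i by (metis of_nat_le_iff of_nat_numeral of_nat_power)
  then have "real i * s \<le> 2 ^ n * s" using s by (intro mult_right_mono) auto
  then have "real i * (s / 2 ^ n) \<in> {0..s}" using s by (simp add: field_simps)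
  then show "X (real i * (s / 2 ^ n)) \<omega> \<in> R" using a by blast
next
  \<comment> \<open>By right continuity a state outside \<open>R\<close> would be kept on
    \<open>[r, r + e)\<close>, and a fine enough grid has a point there. At \<open>r = s\<close>
    that interval leaves \<open>[0, s]\<close>, but \<open>s\<close> is itself a grid point.\<close>
  fix r assume a: "\<forall>n. \<forall>i\<le>2 ^ n. X (real i * (s / 2 ^ n)) \<omega> \<in> R" and r: "r \<in> {0..s}"
  from r have "0 \<le> r" by simp
  from X[THEN spec, THEN mp, OF this] obtain e where e: "e > 0" "\<forall>r'\<in>{r..<r + e}. X r' \<omega> = X r \<omega>"
    by (elim exE conjE)
  show "X r \<omega> \<in> R"
  proof (cases "r = s")
    case True
    then show ?thesis using a[rule_format, of 1 0] by simp
  next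
    case False
    then have s: "s > 0" using r by auto
    obtain n where n: "s / e < 2 ^ n" using real_arch_pow[of 2 "s / e"] by auto
    \<comment> \<open>The first grid point not before \<open>r\<close>. It lies less than one mesh
      \<open>s / 2 ^ n < e\<close> after \<open>r\<close>, and its index is at most
      \<open>2 ^ n\<close> because \<open>r \<le> s\<close>.\<close>
    define i where "i = nat \<lceil>r * 2 ^ n / s\<rceil>"
    have i0: "0 \<le> r * 2 ^ n / s" using r s by simp
    have i1: "r * 2 ^ n / s \<le> real i" unfolding i_def using i0 by linarith
    have i2: "real i < r * 2 ^ n / s + 1" unfolding i_def using i0 by linarith
    have "r * 2 ^ n / s \<le> 2 ^ n" using r s by (simp add: field_simps)
    then have "i \<le> 2 ^ n" unfolding i_def
      by (simp add: nat_le_iff ceiling_le_iff)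
    moreover have "r \<le> real i * (s / 2 ^ n)" using i1 s by (simp add: field_simps)
    moreover have "real i * (s / 2 ^ n) < r + e"
    proof -
      have "real i * (s / 2 ^ n) < (r * 2 ^ n / s + 1) * (s / 2 ^ n)"
        using i2 s by (intro mult_strict_right_mono) auto
      also have "\<dots> = r + s / 2 ^ n" using s by (simp add: field_simps)
      also have "\<dots> < r + e" using n e s by (simp add: field_simps)
      finally show ?thesis .
    qed
    ultimately show ?thesis using e a by (metis atLeastLessThan_iff)
  qed
qed

text \<open>The strict inequality is right because a path that is in \<open>R\<close> at time
  \<open>s\<close> stays there until some \<open>s + e\<close>, and this is a lower bound for the
  infimum.\<close>

lemma hitting_time_greater_iff:
  assumes X: "\<forall>t\<ge>0. \<exists>e>0. \<forall>r\<in>{t..<t + e}. X r \<omega> = X t \<omega>" and s: "0 \<le> s"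
  shows "hitting_time X (- R) \<omega> > ereal s \<longleftrightarrow> (\<forall>r\<in>{0..s}. X r \<omega> \<in> R)"
proof
  assume a: "hitting_time X (- R) \<omega> > ereal s"
  show "\<forall>r\<in>{0..s}. X r \<omega> \<in> R"
  proof (rule ccontr)
    assume "\<not> (\<forall>r\<in>{0..s}. X r \<omega> \<in> R)"
    then obtain r where r: "0 \<le> r" "r \<le> s" "X r \<omega> \<notin> R" by auto
    then have "hitting_time X (- R) \<omega> \<le> ereal r"
      unfolding hitting_time_def by (intro INF_lower) auto
    then show False using a r by (meson ereal_less_eq(3) leD order_trans)
  qed
next
  assume a: "\<forall>r\<in>{0..s}. X r \<omega> \<in> R"
  from X[THEN spec, THEN mp, OF s] obtain e where e: "e > 0" "\<forall>r\<in>{s..<s + e}. X r \<omega> = X s \<omega>"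
    by (elim exE conjE)
  have "ereal (s + e) \<le> hitting_time X (- R) \<omega>"
    unfolding hitting_time_def
  proof (rule INF_greatest)
    fix t assume t: "t \<in> {t. 0 \<le> t \<and> X t \<omega> \<in> - R}"
    have "\<not> t < s + e"
    proof
      assume "t < s + e"
      have "X t \<omega> \<in> R"
      proof (cases "t \<le> s")
        case False
        then have "X t \<omega> = X s \<omega>" using e(2) \<open>t < s + e\<close> by (meson atLeastLessThan_iff linear)
        then show ?thesis using a s by simp
      qed (use a t in auto)
      then show False using t by simp
    qed
    then show "ereal (s + e) \<le> ereal t" by simp
  qed
  moreover have "ereal s < ereal (s + e)" using e(1) by simp
  ultimately show "hitting_time X (- R) \<omega> > ereal s" by (auto intro: less_le_trans[of "ereal s" "ereal (s + e)"])
qed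

text \<open>Each dyadic grid contains the previous one, so the grid events decrease to the event in
  question and their probabilities converge to its probability.\<close>

lemma hitting_time_greater:
  fixes p :: "'a::finite \<Rightarrow> 'a \<Rightarrow> real"
  assumes p: "stochastic_kernel p" and X: "markov_process M X p \<nu>" and s: "0 \<le> s"
  shows "{\<omega>\<in>space M. hitting_time X (- R) \<omega> > ereal s} \<in> sets M"
    and "\<P>(\<omega> in M. hitting_time X (- R) \<omega> > ereal s) = (\<Sum>x\<in>R. pmf \<nu> x * survival R p s x)"
proof -
  interpret prob_space M using X by (simp add: markov_process_def)
  define A where "A = (\<lambda>n::nat. {\<omega>\<in>space M. \<forall>i\<le>2 ^ n. X (real i * (s / 2 ^ n)) \<omega> \<in> R})"
  have X': "\<forall>t\<ge>0. \<exists>e>0. \<forall>r\<in>{t..<t + e}. X r \<omega> = X t \<omega>" if "\<omega> \<in> space M" for \<omega>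
    using X that by (simp add: markov_process_def)
  have eq: "{\<omega>\<in>space M. hitting_time X (- R) \<omega> > ereal s} = (\<Inter>n. A n)"
  proof (intro set_eqI)
    fix \<omega>
    show "\<omega> \<in> {\<omega>\<in>space M. hitting_time X (- R) \<omega> > ereal s} \<longleftrightarrow> \<omega> \<in> (\<Inter>n. A n)"
    proof (cases "\<omega> \<in> space M")
      case True
      show ?thesis
        using hitting_time_greater_iff[where X = X and \<omega> = \<omega> and R = R, OF X'[OF True] s]
          stays_iff_dyadic[where X = X and \<omega> = \<omega> and R = R, OF X'[OF True] s] True
        by (simp add: A_def)
    qed (simp add: A_def)
  qed
  have A: "A n \<in> sets M" for n
    unfolding A_def by (rule markov_process_grid(1)[OF X]) (use s in simp)
  show "{\<omega>\<in>space M. hitting_time X (- R) \<omega> > ereal s} \<in> sets M"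
    unfolding eq using A by (intro sets.countable_INT) auto
  have "decseq A"
  proof (rule decseq_SucI, rule subsetI)
    fix n \<omega> assume \<omega>: "\<omega> \<in> A (Suc n)"
    have "X (real i * (s / 2 ^ n)) \<omega> \<in> R" if "i \<le> 2 ^ n" for i
    proof -
      have "\<forall>j\<le>2 ^ Suc n. X (real j * (s / 2 ^ Suc n)) \<omega> \<in> R" using \<omega> unfolding A_def by blast
      moreover have "2 * i \<le> 2 ^ Suc n" using that by simp
      ultimately have "X (real (2 * i) * (s / 2 ^ Suc n)) \<omega> \<in> R" by blast
      moreover have "real (2 * i) * (s / 2 ^ Suc n) = real i * (s / 2 ^ n)" by simp
      ultimately show ?thesis by (simp only:)
    qed
    then show "\<omega> \<in> A n" using \<omega> by (auto simp: A_def)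
  qed
  then have "(\<lambda>n. measure M (A n)) \<longlonglongrightarrow> measure M (\<Inter>n. A n)"
    using A by (intro finite_Lim_measure_decseq) auto
  moreover have "(\<lambda>n. measure M (A n)) \<longlonglongrightarrow> (\<Sum>x\<in>R. pmf \<nu> x * survival R p s x)"
  proof -
    let ?F = "\<lambda>N. \<Sum>x\<in>R. pmf \<nu> x * (kernel_op R (transition p (s / real (Suc N))) ^^ Suc N) (indicator R) x"
    have lim: "?F \<longlonglongrightarrow> (\<Sum>x\<in>R. pmf \<nu> x * survival R p s x)"
      by (intro tendsto_intros survival_limit[OF p s])
    \<comment> \<open>Grids with \<open>2 ^ n\<close> steps are the subsequence
      \<open>N = 2 ^ n - 1\<close> of those with \<open>Suc N\<close> steps.\<close>
    have "filterlim (\<lambda>n. 2 ^ n - 1 :: nat) sequentially sequentially"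
      by (rule filterlim_subseq) (auto simp: strict_mono_Suc_iff intro: diff_less_mono)
    from filterlim_compose[OF lim this]
    have "(\<lambda>n. ?F (2 ^ n - 1)) \<longlonglongrightarrow> (\<Sum>x\<in>R. pmf \<nu> x * survival R p s x)" .
    moreover have "?F (2 ^ n - 1) = measure M (A n)" for n
    proof -
      have "Suc (2 ^ n - 1) = 2 ^ n" by simp
      then show ?thesis
        unfolding A_def using markov_process_grid(2)[OF X, of "s / 2 ^ n" "2 ^ n" R] s by simp
    qed
    ultimately show ?thesis by (simp only:)
  qed
  ultimately show "\<P>(\<omega> in M. hitting_time X (- R) \<omega> > ereal s) = (\<Sum>x\<in>R. pmf \<nu> x * survival R p s x)"
    unfolding eq by (rule LIMSEQ_unique)
qed

text \<open>\<open>exit_prob\<close> has a strict inequality in the other direction, so its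
  complement is the event that the hitting time is at least \<open>s\<close>. This is a limit of
  events with strict inequality at times \<open>r n\<close> increasing to \<open>s\<close>;
  continuity of \<open>survival\<close> in time shows that nothing is lost.\<close>

lemma hitting_time_less:
  fixes p :: "'a::finite \<Rightarrow> 'a \<Rightarrow> real"
  assumes p: "stochastic_kernel p" and X: "markov_process M X p \<nu>" and s: "0 < s"
  shows "1 - \<P>(\<omega> in M. hitting_time X (- R) \<omega> < ereal s) = (\<Sum>x\<in>R. pmf \<nu> x * survival R p s x)"
proof -
  interpret prob_space M using X by (simp add: markov_process_def)
  let ?\<tau> = "hitting_time X (- R)"
  define r where "r = (\<lambda>n::nat. s - s / real (Suc n))"
  define B where "B = (\<lambda>n. {\<omega>\<in>space M. ?\<tau> \<omega> > ereal (r n)})"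
  have r0: "0 \<le> r n" and r1: "r n < s" for n
    using s by (auto simp: r_def field_simps)
  have rlim: "r \<longlonglongrightarrow> s"
  proof -
    have "(\<lambda>n. s - s * inverse (real (Suc n))) \<longlonglongrightarrow> s - s * 0"
      by (intro tendsto_intros LIMSEQ_inverse_real_of_nat)
    then show ?thesis by (simp add: r_def divide_inverse)
  qed
  have B: "B n \<in> sets M" for n
    unfolding B_def by (rule hitting_time_greater(1)[OF p X r0])
  have "{\<omega>\<in>space M. \<not> ?\<tau> \<omega> < ereal s} = (\<Inter>n. B n)"
  proof (intro set_eqI iffI)
    fix \<omega> assume "\<omega> \<in> {\<omega>\<in>space M. \<not> ?\<tau> \<omega> < ereal s}"
    then show "\<omega> \<in> (\<Inter>n. B n)"
      using r1 by (auto simp: B_def not_less intro: less_le_trans[of "ereal (r _)" "ereal s"])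
  next
    fix \<omega> assume a: "\<omega> \<in> (\<Inter>n. B n)"
    have "ereal s \<le> ?\<tau> \<omega>"
      by (rule LIMSEQ_le_const2[of "\<lambda>n. ereal (r n)"])
        (use a rlim in \<open>auto simp: B_def intro!: less_imp_le\<close>)
    then show "\<omega> \<in> {\<omega>\<in>space M. \<not> ?\<tau> \<omega> < ereal s}" using a by (auto simp: B_def)
  qed
  moreover have "{\<omega>\<in>space M. ?\<tau> \<omega> < ereal s} = space M - {\<omega>\<in>space M. \<not> ?\<tau> \<omega> < ereal s}" by auto
  ultimately have eq: "{\<omega>\<in>space M. ?\<tau> \<omega> < ereal s} = space M - (\<Inter>n. B n)" by simp
  have "(\<Inter>n. B n) \<in> sets M" using B by (intro sets.countable_INT) auto
  then have "1 - \<P>(\<omega> in M. ?\<tau> \<omega> < ereal s) = measure M (\<Inter>n. B n)"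
    unfolding eq by (simp add: prob_compl)
  moreover have "(\<lambda>n. measure M (B n)) \<longlonglongrightarrow> measure M (\<Inter>n. B n)"
  proof (rule finite_Lim_measure_decseq)
    show "decseq B"
    proof (rule decseq_SucI)
      fix n
      have "r n \<le> r (Suc n)" using s by (simp add: r_def field_simps)
      then show "B (Suc n) \<subseteq> B n"
        by (auto simp: B_def intro: le_less_trans[of "ereal (r n)" "ereal (r (Suc n))"])
    qed
  qed (use B in auto)
  moreover have "(\<lambda>n. measure M (B n)) \<longlonglongrightarrow> (\<Sum>x\<in>R. pmf \<nu> x * survival R p s x)"
  proof -
    have "isCont (\<lambda>t. \<Sum>x\<in>R. pmf \<nu> x * survival R p t x) s"
      unfolding survival_def
      by (intro continuous_intros DERIV_isCont[OF heat_DERIV[OF stochastic_stopped_kernel[OF p]]])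
    from isCont_tendsto_compose[OF this rlim] show ?thesis
      unfolding B_def hitting_time_greater(2)[OF p X r0] .
  qed
  ultimately show ?thesis using LIMSEQ_unique by metis
qed

section \<open>The Perron eigenfunction and the quasi-stationary measure\<close>

text \<open>The form attains its maximum on a compact set, the unit vectors of
  \<open>real ^ 'a\<close> supported in \<open>R\<close>; homogeneity extends the bound to all
  vectors.\<close>

lemma rayleigh_maximizer:
  fixes A :: "'a::finite \<Rightarrow> 'a \<Rightarrow> real"
  assumes "R \<noteq> {}"
  obtains v where "(\<Sum>x\<in>R. (v x)\<^sup>2) = 1"
    and "\<And>u. (\<Sum>x\<in>R. \<Sum>y\<in>R. A x y * u x * u y)
      \<le> (\<Sum>x\<in>R. \<Sum>y\<in>R. A x y * v x * v y) * (\<Sum>x\<in>R. (u x)\<^sup>2)"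
proof -
  define Q where "Q u = (\<Sum>x\<in>R. \<Sum>y\<in>R. A x y * u x * u y)" for u
  define S :: "(real ^ 'a) set" where "S = {v. norm v = 1} \<inter> {v. \<forall>x\<in>-R. v $ x = 0}"
  have norm2: "(norm v)\<^sup>2 = (\<Sum>x\<in>R. (v $ x)\<^sup>2)" if "\<forall>x\<in>-R. v $ x = 0" for v :: "real ^ 'a"
  proof -
    have "(norm v)\<^sup>2 = (\<Sum>x\<in>UNIV. (v $ x)\<^sup>2)"
      by (simp add: norm_vec_def L2_set_def sum_nonneg)
    also have "\<dots> = (\<Sum>x\<in>R. (v $ x)\<^sup>2)"
      using that by (intro sum.mono_neutral_right) auto
    finally show ?thesis .
  qed
  have "compact S"
  proof (rule compact_eq_bounded_closed[THEN iffD2], intro conjI)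
    show "bounded S" unfolding S_def by (intro boundedI[of _ 1]) auto
    have "closed (\<Inter>x\<in>-R. {v :: real ^ 'a. v $ x = 0})"
      by (intro closed_INT ballI closed_Collect_eq continuous_intros)
    moreover have "(\<Inter>x\<in>-R. {v :: real ^ 'a. v $ x = 0}) = {v. \<forall>x\<in>-R. v $ x = 0}" by auto
    ultimately show "closed S"
      unfolding S_def by (intro closed_Int closed_Collect_eq continuous_intros) auto
  qed
  moreover have "S \<noteq> {}"
  proof -
    obtain i where "i \<in> R" using assms by auto
    then have "axis i 1 $ x = (0 :: real)" if "x \<notin> R" for x using that by (auto simp: axis_def)
    then have "axis i 1 \<in> S" by (auto simp: S_def norm_axis_1)
    then show ?thesis by auto
  qed
  moreover have "continuous_on S (\<lambda>v. Q (\<lambda>x. v $ x))"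
    unfolding Q_def by (intro continuous_intros)
  ultimately obtain v where v: "v \<in> S" "\<And>u. u \<in> S \<Longrightarrow> Q (\<lambda>x. u $ x) \<le> Q (\<lambda>x. v $ x)"
    using continuous_attains_sup by metis
  have le: "Q u \<le> Q (\<lambda>x. v $ x) * (\<Sum>x\<in>R. (u x)\<^sup>2)" for u :: "'a \<Rightarrow> real"
  proof (cases "\<forall>x\<in>R. u x = 0")
    case True
    then have "Q u = 0" "(\<Sum>x\<in>R. (u x)\<^sup>2) = 0" by (auto simp: Q_def)
    then show ?thesis by simp
  next
    case False
    define n where "n = sqrt (\<Sum>x\<in>R. (u x)\<^sup>2)"
    have npos: "(\<Sum>x\<in>R. (u x)\<^sup>2) > 0"
      using False by (auto simp: less_le sum_nonneg_eq_0_iff sum_nonneg)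
    then have n: "n > 0" "n\<^sup>2 = (\<Sum>x\<in>R. (u x)\<^sup>2)" by (auto simp: n_def)
    define u' :: "real ^ 'a" where "u' = (\<chi> x. if x \<in> R then u x / n else 0)"
    have "(norm u')\<^sup>2 = 1"
      using n npos by (subst norm2) (auto simp: u'_def power_divide simp flip: sum_divide_distrib)
    then have "norm u' = 1" by (metis norm_ge_zero one_power2 power2_eq_iff_nonneg zero_le_one)
    then have "u' \<in> S" by (auto simp: S_def u'_def)
    from v(2)[OF this] have "Q (\<lambda>x. u' $ x) \<le> Q (\<lambda>x. v $ x)" .
    moreover have "Q (\<lambda>x. u' $ x) = Q u / n\<^sup>2"
      unfolding Q_def u'_def sum_divide_distrib
      by (intro sum.cong refl) (auto simp: power2_eq_square)
    ultimately show ?thesis using n npos by (simp add: pos_divide_le_eq)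
  qed
  moreover have "(\<Sum>x\<in>R. (v $ x)\<^sup>2) = 1" using v(1) norm2[of v] by (auto simp: S_def)
  ultimately show thesis using that[of "\<lambda>x. v $ x"] unfolding Q_def by blast
qed

text \<open>As the entries are non-negative, replacing a maximizer of the form by its absolute value
  does not lower the form. The result is still a maximizer, and its first variation along each
  coordinate gives the eigenvalue equation.\<close>

lemma nonneg_symmetric_eigenvector:
  fixes A :: "'a::finite \<Rightarrow> 'a \<Rightarrow> real"
  assumes ne: "R \<noteq> {}" and pos: "\<And>x y. x \<in> R \<Longrightarrow> y \<in> R \<Longrightarrow> 0 \<le> A x y"
    and sym: "\<And>x y. x \<in> R \<Longrightarrow> y \<in> R \<Longrightarrow> A x y = A y x"
  shows "\<exists>v l. (\<forall>x. 0 \<le> v x) \<and> (\<exists>x\<in>R. 0 < v x) \<and> (\<forall>x\<in>R. (\<Sum>y\<in>R. A x y * v y) = l * v x)"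
proof -
  define Q where "Q u = (\<Sum>x\<in>R. \<Sum>y\<in>R. A x y * u x * u y)" for u
  obtain v0 where v0: "(\<Sum>x\<in>R. (v0 x)\<^sup>2) = 1" "\<And>u. Q u \<le> Q v0 * (\<Sum>x\<in>R. (u x)\<^sup>2)"
    using rayleigh_maximizer[OF ne, of A] unfolding Q_def by blast
  define v where "v x = \<bar>v0 x\<bar>" for x
  define l where "l = Q v0"
  have v1: "(\<Sum>x\<in>R. (v x)\<^sup>2) = 1" using v0 by (simp add: v_def)
  have "Q v0 \<le> Q v"
    unfolding Q_def
  proof (intro sum_mono)
    fix x y assume xy: "x \<in> R" "y \<in> R"
    have "A x y * v0 x * v0 y \<le> \<bar>A x y * v0 x * v0 y\<bar>" by simp
    also have "\<dots> = A x y * v x * v y" using pos[OF xy] by (simp add: v_def abs_mult)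
    finally show "A x y * v0 x * v0 y \<le> A x y * v x * v y" .
  qed
  with v0(2)[of v] v1 have Qv: "Q v = l" by (simp add: l_def)
  have le: "Q u \<le> l * (\<Sum>x\<in>R. (u x)\<^sup>2)" for u using v0(2) by (simp add: l_def)
  have eig: "(\<Sum>y\<in>R. A i y * v y) = l * v i" if i: "i \<in> R" for i
  proof (rule ccontr)
    define a where "a = (\<Sum>y\<in>R. A i y * v y) - l * v i"
    define b where "b = \<bar>l - A i i\<bar> + 1"
    assume "(\<Sum>y\<in>R. A i y * v y) \<noteq> l * v i"
    then have a0: "a \<noteq> 0" by (simp add: a_def)
    \<comment> \<open>Compare the form at \<open>v\<close> with the form at \<open>v\<close>
      perturbed by \<open>s\<close> at the coordinate \<open>i\<close>. A first-order term that is
      not 0 contradicts maximality for small \<open>s\<close>; \<open>b\<close> is a positive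
      substitute for the second-order coefficient \<open>l - A i i\<close>.\<close>
    have bound: "2 * s * a \<le> s\<^sup>2 * b" for s
    proof -
      define d :: "'a \<Rightarrow> real" where "d x = (if x = i then 1 else 0)" for x
      have d1: "(\<Sum>x\<in>R. f x * d x) = f i" for f
        using i by (simp add: d_def if_distrib sum.delta cong: if_cong)
      have N: "(\<Sum>x\<in>R. (v x + s * d x)\<^sup>2) = 1 + 2 * s * v i + s\<^sup>2"
      proof -
        have "(\<Sum>x\<in>R. (v x + s * d x)\<^sup>2)
            = (\<Sum>x\<in>R. (v x)\<^sup>2) + (\<Sum>x\<in>R. (2 * s * v x) * d x) + (\<Sum>x\<in>R. (s\<^sup>2 * d x) * d x)"
          by (simp add: power2_eq_square algebra_simps sum.distrib)
        then show ?thesis unfolding d1 v1 by (simp add: d_def)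
      qed
      have "Q (\<lambda>x. v x + s * d x)
          = Q v + s * (\<Sum>x\<in>R. (\<Sum>y\<in>R. A x y * v y) * d x)
            + s * (\<Sum>x\<in>R. v x * (\<Sum>y\<in>R. A x y * d y))
            + s\<^sup>2 * (\<Sum>x\<in>R. (\<Sum>y\<in>R. A x y * d y) * d x)"
        unfolding Q_def
        by (simp add: sum_distrib_left sum_distrib_right power2_eq_square algebra_simps flip: sum.distrib)
      also have "\<dots> = l + s * (\<Sum>y\<in>R. A i y * v y) + s * (\<Sum>x\<in>R. v x * A x i) + s\<^sup>2 * A i i"
        unfolding d1 Qv ..
      also have "(\<Sum>x\<in>R. v x * A x i) = (\<Sum>y\<in>R. A i y * v y)"
        by (intro sum.cong refl) (simp add: sym[OF i])
      finally have "l + 2 * s * (\<Sum>y\<in>R. A i y * v y) + s\<^sup>2 * A i i \<le> l * (1 + 2 * s * v i + s\<^sup>2)"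
        using le[of "\<lambda>x. v x + s * d x"] unfolding N by simp
      then have "2 * s * a \<le> s\<^sup>2 * (l - A i i)" by (simp add: a_def algebra_simps)
      also have "\<dots> \<le> s\<^sup>2 * b" by (intro mult_left_mono) (auto simp: b_def)
      finally show ?thesis .
    qed
    have b: "b > 0" by (simp add: b_def)
    \<comment> \<open>The choice \<open>s = a / b\<close> makes the left side twice the right
      side.\<close>
    have "2 * (a / b) * a \<le> (a / b)\<^sup>2 * b" by (rule bound)
    also have "\<dots> = (a / b) * a" using b by (simp add: power2_eq_square)
    finally have "a * a / b \<le> 0" by simp
    moreover have "a * a > 0" using a0 by (auto simp: zero_less_mult_iff linorder_neq_iff)
    then have "a * a / b > 0" using b by (rule divide_pos_pos)
    ultimately show False by simp
  qed
  have "\<exists>x\<in>R. 0 < v x"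
  proof (rule ccontr)
    assume "\<not> (\<exists>x\<in>R. 0 < v x)"
    then have "(\<Sum>x\<in>R. (v x)\<^sup>2) = 0" by (simp add: v_def)
    with v1 show False by simp
  qed
  then show ?thesis using eig by (intro exI[of _ v] exI[of _ l]) (auto simp: v_def)
qed

text \<open>At a zero of \<open>g\<close> the eigenvalue equation is a vanishing sum of non-negative
  terms, so zeros spread along edges. This yields the positivity of the eigenfunction and later its
  uniqueness.\<close>

lemma nonneg_eigenvector_zero:
  fixes k :: "'a::finite \<Rightarrow> 'a \<Rightarrow> real"
  assumes irr: "irreducible_on R k" and k: "\<And>x y. x \<in> R \<Longrightarrow> y \<in> R \<Longrightarrow> 0 \<le> k x y"
    and g: "\<And>x. x \<in> R \<Longrightarrow> 0 \<le> g x"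
    and eig: "\<And>x. x \<in> R \<Longrightarrow> (\<Sum>y\<in>R. k x y * g y) = l * g x"
    and x0: "x0 \<in> R" "g x0 = (0::real)" and x: "x \<in> R"
  shows "g x = 0"
proof -
  have "(x0, x) \<in> {(u, v). u \<in> R \<and> v \<in> R \<and> 0 < k u v}\<^sup>*"
    using irr x0 x by (simp add: irreducible_on_def)
  then show ?thesis
  proof (induction rule: rtrancl_induct)
    case (step y z)
    then have yz: "y \<in> R" "z \<in> R" "0 < k y z" by auto
    have "(\<Sum>y'\<in>R. k y y' * g y') = 0" using eig[OF yz(1)] step.IH by simp
    then have "k y z * g z = 0"
      using yz k g by (subst (asm) sum_nonneg_eq_0_iff) auto
    then show ?case using yz by simp
  qed (rule x0)
qed

text \<open>\<open>w\<close> stands for the conditional measure. \<open>exits\<close> will force the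
  Perron eigenvalue below 1; \<open>two_states\<close> gives every state of \<open>R\<close> a
  neighbour in \<open>R\<close>, which forces the eigenvalue above 0.\<close>

locale killed_chain =
  fixes p :: "'a::finite \<Rightarrow> 'a \<Rightarrow> real" and R :: "'a set" and w :: "'a \<Rightarrow> real"
  assumes kernel: "stochastic_kernel p"
    and w_pos: "\<And>x. x \<in> R \<Longrightarrow> 0 < w x"
    and w_sum: "(\<Sum>x\<in>R. w x) = 1"
    and w_sym: "\<And>x y. x \<in> R \<Longrightarrow> y \<in> R \<Longrightarrow> w x * p x y = w y * p y x"
    and irreducible: "irreducible_on R p"
    and exits: "\<exists>x\<in>R. \<exists>z. z \<notin> R \<and> 0 < p x z"
    and two_states: "2 \<le> card R"
begin

lemma p_nonneg: "0 \<le> p x y"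
  using kernel by (simp add: stochastic_kernel_def)

lemma p_row_le: "(\<Sum>y\<in>R. p x y) \<le> 1"
proof -
  have "(\<Sum>y\<in>R. p x y) \<le> (\<Sum>y\<in>UNIV. p x y)"
    by (intro sum_mono2) (auto simp: p_nonneg)
  then show ?thesis using kernel by (simp add: stochastic_kernel_def)
qed

text \<open>Self-adjointness of the killed kernel with respect to \<open>w\<close>. The value type
  is general because the spectrum needs complex functions.\<close>

lemma sum_swap_sym:
  fixes f g :: "'a \<Rightarrow> 'b::real_algebra_1"
  shows "(\<Sum>x\<in>R. \<Sum>y\<in>R. of_real (w x * p x y) * (f x * g y))
    = (\<Sum>x\<in>R. \<Sum>y\<in>R. of_real (w x * p x y) * (f y * g x))"
  by (subst sum.swap) (intro sum.cong refl, simp add: w_sym)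

lemma R_nonempty: "R \<noteq> {}"
  using two_states by auto

lemma ex_neighbour:
  assumes x: "x \<in> R"
  shows "\<exists>y\<in>R. 0 < p y x"
proof -
  have "\<exists>y. y \<in> R \<and> y \<noteq> x"
  proof (rule ccontr)
    assume "\<nexists>y. y \<in> R \<and> y \<noteq> x"
    then have "R \<subseteq> {x}" by auto
    then have "card R \<le> card {x}" by (intro card_mono) auto
    with two_states show False by simp
  qed
  then obtain y where y: "y \<in> R" "y \<noteq> x" by auto
  have "(y, x) \<in> {(u, v). u \<in> R \<and> v \<in> R \<and> 0 < p u v}\<^sup>*"
    using irreducible x y by (simp add: irreducible_on_def)
  then show ?thesis using y by (cases rule: rtrancl.cases) auto
qed

text \<open>Conjugation by the square root of \<open>w\<close> turns the reversible kernel into a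
  symmetric matrix \<open>A\<close>. For \<open>l < 1\<close>, sum the eigenvalue equation against
  \<open>w\<close>: all row sums over \<open>R\<close> are at most 1, and one is smaller.\<close>

lemma eigenfunction_exists:
  obtains h l where "\<And>x. x \<in> R \<Longrightarrow> 0 < h x" "(\<Sum>x\<in>R. w x * h x) = 1" "0 < l" "l < 1"
    "\<And>x. x \<in> R \<Longrightarrow> (\<Sum>y\<in>R. p x y * h y) = l * h x"
proof -
  define A where "A x y = sqrt (w x) * p x y / sqrt (w y)" for x y
  have A_sym: "A x y = A y x" if "x \<in> R" "y \<in> R" for x y
  proof -
    have "A x y = (w x * p x y) / (sqrt (w x) * sqrt (w y))"
      using w_pos[OF that(1)] by (simp add: A_def divide_simps)
    moreover have "A y x = (w y * p y x) / (sqrt (w x) * sqrt (w y))"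
      using w_pos[OF that(2)] by (simp add: A_def divide_simps)
    ultimately show ?thesis using w_sym[OF that] by simp
  qed
  have A_pos: "0 \<le> A x y" if "x \<in> R" "y \<in> R" for x y
    using w_pos[OF that(1)] w_pos[OF that(2)] p_nonneg[of x y] by (simp add: A_def)
  obtain v l where v: "\<And>x. 0 \<le> v x" "\<exists>x\<in>R. 0 < v x"
    "\<And>x. x \<in> R \<Longrightarrow> (\<Sum>y\<in>R. A x y * v y) = l * v x"
    using nonneg_symmetric_eigenvector[where A = A, OF R_nonempty A_pos A_sym] by blast
  define g where "g x = v x / sqrt (w x)" for x
  have eig: "(\<Sum>y\<in>R. p x y * g y) = l * g x" if x: "x \<in> R" for x
  proof -
    have "sqrt (w x) * (\<Sum>y\<in>R. p x y * g y) = l * v x"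
      using v(3)[OF x] by (simp add: A_def g_def sum_distrib_left mult.assoc)
    then show ?thesis using w_pos[OF x] by (simp add: g_def field_simps)
  qed
  have g0: "0 \<le> g x" if "x \<in> R" for x using v(1) w_pos[OF that] by (simp add: g_def)
  obtain x1 where x1: "x1 \<in> R" "0 < v x1" using v by auto
  have g_pos: "0 < g x" if x: "x \<in> R" for x
  proof (rule ccontr)
    assume "\<not> 0 < g x"
    with g0[OF x] have "g x = 0" by simp
    from nonneg_eigenvector_zero[OF irreducible p_nonneg g0 eig x this x1(1)]
    show False using x1 w_pos[OF x1(1)] by (simp add: g_def)
  qed
  define c where "c = (\<Sum>x\<in>R. w x * g x)"
  have c: "c > 0"
    unfolding c_def using R_nonempty g_pos w_pos by (intro sum_pos) auto
  have "l > 0"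
  proof -
    obtain y where y: "y \<in> R" "0 < p y x1" using ex_neighbour[OF x1(1)] by auto
    have "0 < p y x1 * g x1" using y g_pos[OF x1(1)] by simp
    also have "\<dots> \<le> (\<Sum>z\<in>R. p y z * g z)"
      using x1 g0 p_nonneg by (intro member_le_sum) auto
    also have "\<dots> = l * g y" by (rule eig[OF y(1)])
    finally show ?thesis using g_pos[OF y(1)] by (simp add: zero_less_mult_iff)
  qed
  moreover have "l < 1"
  proof -
    have "l * c = (\<Sum>x\<in>R. \<Sum>y\<in>R. (w x * p x y) * g y)"
      unfolding c_def sum_distrib_left
      by (intro sum.cong refl) (simp add: mult.assoc eig mult.left_commute flip: sum_distrib_left)
    also have "\<dots> = (\<Sum>x\<in>R. \<Sum>y\<in>R. (w x * p x y) * g x)"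
      using sum_swap_sym[where f = "\<lambda>_. 1::real" and g = g] by simp
    also have "\<dots> = (\<Sum>x\<in>R. w x * g x * (\<Sum>y\<in>R. p x y))"
      by (simp add: sum_distrib_left mult_ac)
    also have "\<dots> < (\<Sum>x\<in>R. w x * g x * 1)"
    proof (rule sum_strict_mono_ex1)
      show "\<forall>x\<in>R. w x * g x * (\<Sum>y\<in>R. p x y) \<le> w x * g x * 1"
        using p_row_le w_pos g0 by (intro ballI mult_left_mono) (auto simp: less_imp_le)
      obtain x z where xz: "x \<in> R" "z \<notin> R" "0 < p x z" using exits by auto
      have "(\<Sum>y\<in>R. p x y) < (\<Sum>y\<in>UNIV. p x y)"
        using xz p_nonneg by (intro sum_strict_mono2[of _ _ z]) auto
      also have "\<dots> = 1" using kernel by (simp add: stochastic_kernel_def)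
      finally show "\<exists>x\<in>R. w x * g x * (\<Sum>y\<in>R. p x y) < w x * g x * 1"
        using xz w_pos g_pos by (intro bexI[of _ x] mult_strict_left_mono) auto
    qed simp
    finally show ?thesis using c by (simp add: c_def)
  qed
  moreover have "(\<Sum>x\<in>R. w x * (g x / c)) = 1"
    using c by (simp add: c_def flip: sum_divide_distrib)
  moreover have "(\<Sum>y\<in>R. p x y * (g y / c)) = l * (g x / c)" if "x \<in> R" for x
    using eig[OF that] by (simp flip: sum_divide_distrib)
  ultimately show thesis using that[of "\<lambda>x. g x / c" l] g_pos c by auto
qed

text \<open>Chosen jointly because \<open>l\<close> belongs to \<open>h\<close>;
  \<open>spectral_radius\<close> and \<open>eigenfunction_unique\<close> show that the choice was
  forced on \<open>R\<close>.\<close>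

definition eigen_pair :: "('a \<Rightarrow> real) \<times> real" where
  "eigen_pair = (SOME (h, l). (\<forall>x\<in>R. 0 < h x) \<and> (\<Sum>x\<in>R. w x * h x) = 1 \<and> 0 < l \<and> l < 1 \<and>
     (\<forall>x\<in>R. (\<Sum>y\<in>R. p x y * h y) = l * h x))"

definition h :: "'a \<Rightarrow> real" where "h = fst eigen_pair"

definition l :: real where "l = snd eigen_pair"

lemma h_l: "(\<forall>x\<in>R. 0 < h x) \<and> (\<Sum>x\<in>R. w x * h x) = 1 \<and> 0 < l \<and> l < 1 \<and>
     (\<forall>x\<in>R. (\<Sum>y\<in>R. p x y * h y) = l * h x)"
proof -
  let ?P = "\<lambda>(h, l). (\<forall>x\<in>R. 0 < h x) \<and> (\<Sum>x\<in>R. w x * h x) = 1 \<and> 0 < l \<and> l < 1 \<and>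
     (\<forall>x\<in>R. (\<Sum>y\<in>R. p x y * h y) = l * h x)"
  obtain h l where "\<And>x. x \<in> R \<Longrightarrow> 0 < h x" "(\<Sum>x\<in>R. w x * h x) = 1" "0 < l" "l < 1"
    "\<And>x. x \<in> R \<Longrightarrow> (\<Sum>y\<in>R. p x y * h y) = l * h x"
    by (rule eigenfunction_exists, rule that)
  then have "?P (h, l)" by simp
  then have "?P eigen_pair" unfolding eigen_pair_def by (rule someI[of ?P])
  then show ?thesis by (simp add: h_def l_def case_prod_beta)
qed

lemma h_pos: "x \<in> R \<Longrightarrow> 0 < h x"
  and h_sum: "(\<Sum>x\<in>R. w x * h x) = 1"
  and l_pos: "0 < l" and l_less_1: "l < 1"
  and h_eigen: "x \<in> R \<Longrightarrow> (\<Sum>y\<in>R. p x y * h y) = l * h x"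
  using h_l by auto

section \<open>Spectrum and spectral radius\<close>

lemma hermitian:
  fixes f g :: "'a \<Rightarrow> complex"
  assumes f: "\<And>x. x \<in> R \<Longrightarrow> (\<Sum>y\<in>R. of_real (p x y) * f y) = c * f x"
    and g: "\<And>x. x \<in> R \<Longrightarrow> (\<Sum>y\<in>R. of_real (p x y) * g y) = d * g x"
  shows "(c - cnj d) * (\<Sum>x\<in>R. of_real (w x) * (f x * cnj (g x))) = 0"
proof -
  have "c * (\<Sum>x\<in>R. of_real (w x) * (f x * cnj (g x)))
      = (\<Sum>x\<in>R. of_real (w x) * cnj (g x) * (c * f x))"
    by (simp add: sum_distrib_left mult_ac)
  also have "\<dots> = (\<Sum>x\<in>R. of_real (w x) * cnj (g x) * (\<Sum>y\<in>R. of_real (p x y) * f y))"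
    by (simp add: f)
  also have "\<dots> = (\<Sum>x\<in>R. \<Sum>y\<in>R. of_real (w x * p x y) * (cnj (g x) * f y))"
    by (simp add: sum_distrib_left mult_ac)
  \<comment> \<open>Detailed balance moves the kernel from \<open>f\<close> to
    \<open>g\<close>.\<close>
  also have "\<dots> = (\<Sum>x\<in>R. \<Sum>y\<in>R. of_real (w x * p x y) * (cnj (g y) * f x))"
    by (rule sum_swap_sym)
  also have "\<dots> = (\<Sum>x\<in>R. of_real (w x) * f x * cnj (\<Sum>y\<in>R. of_real (p x y) * g y))"
    by (simp add: sum_distrib_left mult_ac)
  also have "\<dots> = (\<Sum>x\<in>R. of_real (w x) * f x * cnj (d * g x))"
    by (simp add: g)
  also have "\<dots> = cnj d * (\<Sum>x\<in>R. of_real (w x) * (f x * cnj (g x)))"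
    by (simp add: sum_distrib_left mult_ac)
  finally show ?thesis by (simp add: algebra_simps)
qed

text \<open>The spectral radius is a \<open>Max\<close>, which is meaningful only for a finite set.
  By \<open>hermitian\<close> eigenvalues are real and eigenvectors of distinct eigenvalues
  orthogonal, and a pairwise orthogonal set in finite dimension is finite.\<close>

lemma finite_spectrum: "finite (spectrum_on R p)"
proof -
  define P where "P c f \<longleftrightarrow> (\<exists>x\<in>R. f x \<noteq> 0) \<and>
     (\<forall>x\<in>R. (\<Sum>y\<in>R. complex_of_real (p x y) * f y) = c * f x)" for c f
  have "\<forall>c\<in>spectrum_on R p. \<exists>f. P c f" by (auto simp: spectrum_on_def P_def)
  then obtain F where F: "\<And>c. c \<in> spectrum_on R p \<Longrightarrow> P c (F c)" by metis
  \<comment> \<open>The square-root weight makes the standard real inner product of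
    \<open>complex ^ 'a\<close> the real part of the \<open>w\<close>-weighted Hermitian
    one.\<close>
  define V :: "complex \<Rightarrow> complex ^ 'a" where
    "V c = (\<chi> x. if x \<in> R then of_real (sqrt (w x)) * F c x else 0)" for c
  have inn: "V c \<bullet> V d = Re (\<Sum>x\<in>R. of_real (w x) * (F c x * cnj (F d x)))" for c d
  proof -
    have "V c \<bullet> V d = (\<Sum>x\<in>R. (of_real (sqrt (w x)) * F c x) \<bullet> (of_real (sqrt (w x)) * F d x))"
      unfolding inner_vec_def V_def
      by (intro sum.mono_neutral_cong_right) auto
    also have "\<dots> = (\<Sum>x\<in>R. w x * (F c x \<bullet> F d x))"
    proof (intro sum.cong refl)
      fix x assume "x \<in> R"
      then have "sqrt (w x) * sqrt (w x) = w x" using w_pos[of x] by simp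
      then show "(of_real (sqrt (w x)) * F c x) \<bullet> (of_real (sqrt (w x)) * F d x) = w x * (F c x \<bullet> F d x)"
        by (simp add: inner_mult_left inner_mult_right flip: scaleR_conv_of_real mult.assoc)
    qed
    also have "\<dots> = Re (\<Sum>x\<in>R. of_real (w x) * (F c x * cnj (F d x)))"
      by (simp add: inner_complex_def)
    finally show ?thesis .
  qed
  have pos: "V c \<bullet> V c > 0" if c: "c \<in> spectrum_on R p" for c
  proof -
    obtain x where "x \<in> R" "F c x \<noteq> 0" using F[OF c] by (auto simp: P_def)
    then have "V c $ x \<noteq> 0" using w_pos[of x] by (simp add: V_def)
    then have "V c \<noteq> 0" by auto
    then show ?thesis by simp
  qed
  have real: "cnj c = c" if "c \<in> spectrum_on R p" for c
  proof -
    have "(\<Sum>x\<in>R. of_real (w x) * (F c x * cnj (F c x))) \<noteq> 0"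
    proof
      assume "(\<Sum>x\<in>R. of_real (w x) * (F c x * cnj (F c x))) = 0"
      then have "V c \<bullet> V c = 0" unfolding inn by (simp only: zero_complex.sel)
      with pos[OF that] show False by simp
    qed
    moreover have "(c - cnj c) * (\<Sum>x\<in>R. of_real (w x) * (F c x * cnj (F c x))) = 0"
      using F[OF that] by (intro hermitian) (auto simp: P_def)
    ultimately show ?thesis by simp
  qed
  have orth: "V c \<bullet> V d = 0" if "c \<in> spectrum_on R p" "d \<in> spectrum_on R p" "c \<noteq> d" for c d
  proof -
    have "(c - cnj d) * (\<Sum>x\<in>R. of_real (w x) * (F c x * cnj (F d x))) = 0"
      using F[OF that(1)] F[OF that(2)] by (intro hermitian) (auto simp: P_def)
    then show ?thesis using that real unfolding inn by auto
  qed
  have "finite (V ` spectrum_on R p)"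
  proof (rule pairwise_orthogonal_imp_finite)
    show "pairwise orthogonal (V ` spectrum_on R p)"
      unfolding pairwise_image pairwise_def orthogonal_def using orth by auto
  qed
  moreover have "inj_on V (spectrum_on R p)"
  proof (rule inj_onI, rule ccontr)
    fix c d assume cd: "c \<in> spectrum_on R p" "d \<in> spectrum_on R p" "V c = V d" "c \<noteq> d"
    then show False using orth[OF cd(1,2,4)] pos[OF cd(1)] by simp
  qed
  ultimately show ?thesis by (rule finite_imageD)
qed

text \<open>For an eigenfunction \<open>f\<close> with eigenvalue \<open>c\<close>, the kernel
  applied to \<open>cmod (f x)\<close> dominates \<open>cmod c * cmod (f x)\<close>. Summing against
  \<open>w x * h x\<close> and moving the kernel onto \<open>h\<close> leaves
  \<open>cmod c \<le> l\<close>.\<close>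

lemma spectral_radius: "spectral_radius_on R p = l"
  unfolding spectral_radius_on_def
proof (rule Max_eqI)
  show "finite (cmod ` spectrum_on R p)" using finite_spectrum by simp
  have "complex_of_real l \<in> spectrum_on R p"
    unfolding spectrum_on_def
  proof (intro CollectI exI[of _ "\<lambda>x. complex_of_real (h x)"] conjI ballI)
    show "\<exists>x\<in>R. complex_of_real (h x) \<noteq> 0" using R_nonempty h_pos by fastforce
    fix x assume "x \<in> R"
    then show "(\<Sum>y\<in>R. complex_of_real (p x y) * complex_of_real (h y)) = complex_of_real l * complex_of_real (h x)"
      by (simp add: h_eigen flip: of_real_mult of_real_sum)
  qed
  then show "l \<in> cmod ` spectrum_on R p"
    using l_pos by (intro image_eqI[of _ _ "complex_of_real l"]) auto
next
  fix r assume "r \<in> cmod ` spectrum_on R p"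
  then obtain c f where c: "r = cmod c" and f: "\<exists>x\<in>R. f x \<noteq> 0"
    "\<And>x. x \<in> R \<Longrightarrow> (\<Sum>y\<in>R. complex_of_real (p x y) * f y) = c * f x"
    by (auto simp: spectrum_on_def)
  have "cmod c * (\<Sum>x\<in>R. w x * h x * cmod (f x)) = (\<Sum>x\<in>R. w x * h x * cmod (c * f x))"
    by (simp add: sum_distrib_left norm_mult mult_ac)
  also have "\<dots> \<le> (\<Sum>x\<in>R. w x * h x * (\<Sum>y\<in>R. p x y * cmod (f y)))"
  proof (intro sum_mono mult_left_mono)
    fix x assume x: "x \<in> R"
    show "cmod (c * f x) \<le> (\<Sum>y\<in>R. p x y * cmod (f y))"
      unfolding f(2)[OF x, symmetric]
      by (rule order_trans[OF norm_sum]) (simp add: norm_mult p_nonneg)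
    show "0 \<le> w x * h x" using w_pos[OF x] h_pos[OF x] by simp
  qed
  also have "\<dots> = (\<Sum>x\<in>R. \<Sum>y\<in>R. of_real (w x * p x y) * (h x * cmod (f y)))"
    by (simp add: sum_distrib_left mult_ac)
  also have "\<dots> = (\<Sum>x\<in>R. \<Sum>y\<in>R. of_real (w x * p x y) * (h y * cmod (f x)))"
    by (rule sum_swap_sym)
  also have "\<dots> = (\<Sum>x\<in>R. w x * cmod (f x) * (\<Sum>y\<in>R. p x y * h y))"
    by (simp add: sum_distrib_left mult_ac)
  also have "\<dots> = l * (\<Sum>x\<in>R. w x * h x * cmod (f x))"
    by (simp add: h_eigen sum_distrib_left mult_ac)
  finally have "cmod c * (\<Sum>x\<in>R. w x * h x * cmod (f x)) \<le> l * (\<Sum>x\<in>R. w x * h x * cmod (f x))" .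
  moreover have "(\<Sum>x\<in>R. w x * h x * cmod (f x)) > 0"
  proof -
    obtain x where x: "x \<in> R" "f x \<noteq> 0" using f by auto
    show ?thesis
      by (rule sum_pos2[OF _ x(1)])
        (use x w_pos h_pos in \<open>auto simp: zero_less_mult_iff less_imp_le intro!: mult_nonneg_nonneg\<close>)
  qed
  ultimately show "r \<le> l" unfolding c by simp
qed

lemma phi_star_eq: "phi_star R p = 1 - l"
  by (simp add: phi_star_def spectral_radius)

section \<open>Uniqueness and the quasi-stationary measure\<close>

lemma eigenfunction_unique:
  assumes f: "\<And>x. x \<in> R \<Longrightarrow> 0 \<le> f x" "(\<Sum>x\<in>R. w x * f x) = 1"
    and eig: "\<And>x. x \<in> R \<Longrightarrow> (\<Sum>y\<in>R. p x y * f y) = l * f x"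
    and x: "x \<in> R"
  shows "f x = h x"
proof -
  \<comment> \<open>The largest multiple of \<open>h\<close> below \<open>f\<close> on
    \<open>R\<close>: the difference \<open>g\<close> is a non-negative eigenfunction with a zero,
    so it vanishes on \<open>R\<close>.\<close>
  define c where "c = Min ((\<lambda>x. f x / h x) ` R)"
  define g where "g x = f x - c * h x" for x
  have "c \<in> (\<lambda>x. f x / h x) ` R" unfolding c_def using R_nonempty by (intro Min_in) auto
  then obtain x0 where x0: "x0 \<in> R" "g x0 = 0" using h_pos by (fastforce simp: g_def)
  have g0: "0 \<le> g y" if "y \<in> R" for y
  proof -
    have "c \<le> f y / h y" unfolding c_def using that by (intro Min_le) auto
    then show ?thesis using h_pos[OF that] by (simp add: g_def field_simps)
  qed
  have geig: "(\<Sum>z\<in>R. p y z * g z) = l * g y" if "y \<in> R" for y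
  proof -
    have "(\<Sum>z\<in>R. p y z * g z) = (\<Sum>z\<in>R. p y z * f z) - c * (\<Sum>z\<in>R. p y z * h z)"
      by (simp add: g_def algebra_simps sum_subtractf sum_distrib_left)
    also have "\<dots> = l * g y" unfolding eig[OF that] h_eigen[OF that] by (simp add: g_def algebra_simps)
    finally show ?thesis .
  qed
  have fh: "f y = c * h y" if "y \<in> R" for y
    using nonneg_eigenvector_zero[OF irreducible p_nonneg g0 geig x0 that] by (simp add: g_def)
  have "1 = (\<Sum>x\<in>R. c * (w x * h x))" unfolding f(2)[symmetric] by (simp add: fh mult_ac)
  then have "c = 1" by (simp add: h_sum flip: sum_distrib_left)
  then show ?thesis using fh[OF x] by simp
qed

text \<open>By detailed balance, \<open>m\<close> solves the left eigenvalue equation exactly when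
  its density with respect to \<open>w\<close> solves the right one. Existence and uniqueness of
  \<open>h\<close> thus settle the definite description.\<close>

lemma pmf_quasi_stationary:
  "pmf (quasi_stationary R p) x = (if x \<in> R then w x * h x else 0)"
proof -
  define q where "q x = (if x \<in> R then w x * h x else 0)" for x
  have q0: "0 \<le> q x" for x using w_pos h_pos by (auto simp: q_def less_imp_le)
  have "(\<Sum>x\<in>UNIV. q x) = 1" by (simp add: q_def sum.If_cases h_sum)
  then have "(\<integral>\<^sup>+ x. ennreal (q x) \<partial>count_space UNIV) = 1"
    by (simp add: nn_integral_count_space_finite q0)
  then have pmf_q: "pmf (embed_pmf q) x = q x" for x
    by (intro pmf_embed_pmf q0)
  have "quasi_stationary R p = embed_pmf q"
    unfolding quasi_stationary_def phi_star_eq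
  proof (rule the_equality)
    show "set_pmf (embed_pmf q) \<subseteq> R \<and>
       (\<forall>y\<in>R. (\<Sum>x\<in>R. pmf (embed_pmf q) x * p x y) = (1 - (1 - l)) * pmf (embed_pmf q) y)"
    proof (intro conjI ballI)
      show "set_pmf (embed_pmf q) \<subseteq> R" by (auto simp: set_pmf_iff pmf_q q_def split: if_splits)
      fix y assume y: "y \<in> R"
      have "(\<Sum>x\<in>R. q x * p x y) = (\<Sum>x\<in>R. w y * (p y x * h x))"
      proof (intro sum.cong refl)
        fix x assume x: "x \<in> R"
        show "q x * p x y = w y * (p y x * h x)"
          using w_sym[OF x y] x by (simp add: q_def)
      qed
      also have "\<dots> = l * q y" using y by (simp add: q_def h_eigen flip: sum_distrib_left)
      finally show "(\<Sum>x\<in>R. pmf (embed_pmf q) x * p x y) = (1 - (1 - l)) * pmf (embed_pmf q) y"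
        by (simp add: pmf_q)
    qed
  next
    fix m :: "'a pmf"
    assume m: "set_pmf m \<subseteq> R \<and> (\<forall>y\<in>R. (\<Sum>x\<in>R. pmf m x * p x y) = (1 - (1 - l)) * pmf m y)"
    define f where "f x = pmf m x / w x" for x
    have wf: "w x * f x = pmf m x" if "x \<in> R" for x using w_pos[OF that] by (simp add: f_def)
    have "f x = h x" if "x \<in> R" for x
    proof (rule eigenfunction_unique[OF _ _ _ that])
      fix x assume x: "x \<in> R"
      show "0 \<le> f x" using w_pos[OF x] by (simp add: f_def)
      have "w x * (\<Sum>y\<in>R. p x y * f y) = (\<Sum>y\<in>R. pmf m y * p y x)"
        unfolding sum_distrib_left
      proof (intro sum.cong refl)
        fix y assume y: "y \<in> R"
        have "w x * (p x y * f y) = (w x * p x y) * f y" by simp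
        also have "\<dots> = (w y * f y) * p y x" unfolding w_sym[OF x y] by simp
        finally show "w x * (p x y * f y) = pmf m y * p y x" unfolding wf[OF y] .
      qed
      also have "\<dots> = w x * (l * f x)" using m x wf[OF x] by simp
      finally show "(\<Sum>y\<in>R. p x y * f y) = l * f x" using w_pos[OF x] by simp
    next
      show "(\<Sum>x\<in>R. w x * f x) = 1"
        using m sum_pmf_eq_1[of R m] by (simp add: wf)
    qed
    then have "pmf m x = q x" for x
      using m wf by (cases "x \<in> R") (auto simp: q_def pmf_eq_0_set_pmf)
    then show "m = embed_pmf q" by (intro pmf_eqI) (simp add: pmf_q)
  qed
  then show ?thesis by (simp add: pmf_q q_def)
qed

end

section \<open>Relaxation of the killed semigroup\<close>

context killed_chain
begin

text \<open>Written with \<open>p\<close> instead of the restricted kernel: they differ only on the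
  diagonal, where the squared difference vanishes.\<close>

definition Dir :: "('a \<Rightarrow> real) \<Rightarrow> real" where
  "Dir f = 1 / 2 * (\<Sum>x\<in>R. \<Sum>y\<in>R. w x * p x y * (f x - f y)\<^sup>2)"

definition Var :: "('a \<Rightarrow> real) \<Rightarrow> real" where
  "Var f = (\<Sum>x\<in>R. w x * (f x - (\<Sum>y\<in>R. w y * f y))\<^sup>2)"

lemma Var_eq: "Var f = (\<Sum>x\<in>R. w x * (f x)\<^sup>2) - (\<Sum>x\<in>R. w x * f x)\<^sup>2"
proof -
  define m where "m = (\<Sum>x\<in>R. w x * f x)"
  have "Var f = (\<Sum>x\<in>R. w x * (f x)\<^sup>2 - 2 * m * (w x * f x) + m\<^sup>2 * w x)"
    unfolding Var_def m_def[symmetric]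
    by (intro sum.cong refl) (simp add: power2_eq_square algebra_simps)
  also have "\<dots> = (\<Sum>x\<in>R. w x * (f x)\<^sup>2) - 2 * m * (\<Sum>x\<in>R. w x * f x) + m\<^sup>2 * (\<Sum>x\<in>R. w x)"
    by (simp add: sum.distrib sum_subtractf sum_distrib_left)
  finally show ?thesis by (simp add: w_sum power2_eq_square flip: m_def)
qed

lemma Dir_nonneg: "0 \<le> Dir f"
  unfolding Dir_def using w_pos p_nonneg by (intro mult_nonneg_nonneg sum_nonneg) (auto simp: less_imp_le)

text \<open>Each edge of a path contributes its squared increment, times a positive weight, to twice
  the Dirichlet form; the triangle inequality adds up the increments.\<close>

lemma path_difference:
  assumes "x \<in> R" "y \<in> R"
  shows "\<exists>K\<ge>0. \<forall>f. \<bar>f x - f y\<bar> \<le> K * sqrt (Dir f)"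
proof -
  have "(x, y) \<in> {(u, v). u \<in> R \<and> v \<in> R \<and> 0 < p u v}\<^sup>*"
    using irreducible assms by (simp add: irreducible_on_def)
  then show ?thesis
  proof (induction rule: rtrancl_induct)
    case (step y z)
    then have yz: "y \<in> R" "z \<in> R" "0 < p y z" by auto
    obtain K where K: "K \<ge> 0" "\<And>f. \<bar>f x - f y\<bar> \<le> K * sqrt (Dir f)" using step.IH by auto
    define a where "a = w y * p y z"
    have a: "a > 0" using yz w_pos by (simp add: a_def)
    have "\<bar>f y - f z\<bar> \<le> sqrt (2 / a) * sqrt (Dir f)" for f
    proof -
      have "a * (f y - f z)\<^sup>2 \<le> (\<Sum>v\<in>R. w y * p y v * (f y - f v)\<^sup>2)"
        unfolding a_def using yz w_pos p_nonneg
        by (intro member_le_sum) (auto simp: less_imp_le)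
      also have "\<dots> \<le> (\<Sum>u\<in>R. \<Sum>v\<in>R. w u * p u v * (f u - f v)\<^sup>2)"
        using yz w_pos p_nonneg
        by (intro member_le_sum[of y R "\<lambda>u. \<Sum>v\<in>R. w u * p u v * (f u - f v)\<^sup>2"] sum_nonneg)
          (auto simp: less_imp_le)
      also have "\<dots> = 2 * Dir f" by (simp add: Dir_def)
      finally have "(f y - f z)\<^sup>2 \<le> 2 / a * Dir f" using a by (simp add: field_simps)
      then have "sqrt ((f y - f z)\<^sup>2) \<le> sqrt (2 / a * Dir f)" by (rule real_sqrt_le_mono)
      then show ?thesis by (simp only: real_sqrt_abs real_sqrt_mult)
    qed
    moreover have "\<bar>f x - f z\<bar> \<le> \<bar>f x - f y\<bar> + \<bar>f y - f z\<bar>" for f :: "'a \<Rightarrow> real" by simp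
    ultimately have "\<bar>f x - f z\<bar> \<le> (K + sqrt (2 / a)) * sqrt (Dir f)" for f
      using K(2)[of f] by (smt (verit) distrib_right)
    moreover have "0 \<le> K + sqrt (2 / a)" using K(1) a by simp
    ultimately show ?case by blast
  qed auto
qed

text \<open>The spectral gap is an infimum of quotients; this bounds them away from 0 and so makes
  the gap positive. Any constant will do.\<close>

lemma poincare_inequality: "\<exists>K>0. \<forall>f. Var f \<le> K * Dir f"
proof -
  have "\<forall>x\<in>R. \<forall>y\<in>R. \<exists>K\<ge>0. \<forall>f. \<bar>f x - f y\<bar> \<le> K * sqrt (Dir f)"
    using path_difference by blast
  then obtain K where K: "\<And>x y. x \<in> R \<Longrightarrow> y \<in> R \<Longrightarrow> 0 \<le> K x y"
    "\<And>x y f. x \<in> R \<Longrightarrow> y \<in> R \<Longrightarrow> \<bar>f x - f y\<bar> \<le> K x y * sqrt (Dir f)"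
    by metis
  define L where "L = (\<Sum>x\<in>R. \<Sum>y\<in>R. K x y)"
  have L0: "0 \<le> L" unfolding L_def using K by (intro sum_nonneg) auto
  have KL: "K x y \<le> L" if "x \<in> R" "y \<in> R" for x y
  proof -
    have "K x y \<le> (\<Sum>y\<in>R. K x y)" using that K by (intro member_le_sum) auto
    also have "\<dots> \<le> L" unfolding L_def using that K
      by (intro member_le_sum[of x R "\<lambda>x. \<Sum>y\<in>R. K x y"] sum_nonneg) auto
    finally show ?thesis .
  qed
  have "Var f \<le> (L\<^sup>2 + 1) * Dir f" for f
  proof -
    define m where "m = (\<Sum>y\<in>R. w y * f y)"
    have "(f x - m)\<^sup>2 \<le> L\<^sup>2 * Dir f" if x: "x \<in> R" for x
    proof -
      have "f x - m = (\<Sum>y\<in>R. w y * (f x - f y))"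
        unfolding m_def by (simp add: right_diff_distrib sum_subtractf w_sum flip: sum_distrib_right)
      then have "\<bar>f x - m\<bar> \<le> (\<Sum>y\<in>R. w y * \<bar>f x - f y\<bar>)"
        using w_pos by (auto simp: abs_mult less_imp_le intro!: order_trans[OF sum_abs] sum_mono)
      also have "\<dots> \<le> (\<Sum>y\<in>R. w y * (L * sqrt (Dir f)))"
      proof (intro sum_mono mult_left_mono)
        fix y assume y: "y \<in> R"
        have "K x y * sqrt (Dir f) \<le> L * sqrt (Dir f)"
          using KL[OF x y] by (intro mult_right_mono) (auto simp: Dir_nonneg)
        then show "\<bar>f x - f y\<bar> \<le> L * sqrt (Dir f)" using K(2)[OF x y, of f] by linarith
      qed (use w_pos in \<open>auto simp: less_imp_le\<close>)
      also have "\<dots> = L * sqrt (Dir f)" by (simp add: w_sum flip: sum_distrib_right)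
      finally have "\<bar>f x - m\<bar>\<^sup>2 \<le> (L * sqrt (Dir f))\<^sup>2" by (intro power_mono) auto
      then show ?thesis by (simp add: power_mult_distrib Dir_nonneg)
    qed
    then have "Var f \<le> (\<Sum>x\<in>R. w x * (L\<^sup>2 * Dir f))"
      unfolding Var_def m_def[symmetric] using w_pos
      by (intro sum_mono mult_left_mono) (auto simp: less_imp_le)
    also have "\<dots> = L\<^sup>2 * Dir f" by (simp add: w_sum flip: sum_distrib_right)
    finally show ?thesis using Dir_nonneg[of f] by (simp add: algebra_simps)
  qed
  moreover have "L\<^sup>2 + 1 > 0" by (simp add: add_nonneg_pos)
  ultimately show ?thesis by blast
qed

definition killed_form :: "('a \<Rightarrow> real) \<Rightarrow> real" where
  "killed_form f = (\<Sum>x\<in>R. w x * f x * (f x - (\<Sum>y\<in>R. p x y * f y)))"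

text \<open>The difference is the killing term, the sum of \<open>w x * (f x)\<^sup>2\<close> times
  the one-step probability of leaving \<open>R\<close> from \<open>x\<close>.\<close>

lemma Dir_le_killed_form: "Dir f \<le> killed_form f"
proof -
  let ?c = "\<Sum>x\<in>R. \<Sum>y\<in>R. w x * p x y * (f x * f y)"
  let ?s = "\<Sum>x\<in>R. \<Sum>y\<in>R. w x * p x y * (f x)\<^sup>2"
  have "(\<Sum>x\<in>R. \<Sum>y\<in>R. w x * p x y * (f y)\<^sup>2) = ?s"
    using sum_swap_sym[where f = "\<lambda>_. 1::real" and g = "\<lambda>x. (f x)\<^sup>2"] by simp
  then have "2 * Dir f = ?s + ?s - 2 * ?c"
    unfolding Dir_def
    by (simp add: power2_diff algebra_simps sum.distrib sum_subtractf sum_distrib_left)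
  moreover have "?s \<le> (\<Sum>x\<in>R. w x * (f x)\<^sup>2)"
  proof (rule sum_mono)
    fix x assume x: "x \<in> R"
    have "(\<Sum>y\<in>R. w x * p x y * (f x)\<^sup>2) = w x * (f x)\<^sup>2 * (\<Sum>y\<in>R. p x y)"
      unfolding sum_distrib_left by (simp add: mult_ac)
    also have "\<dots> \<le> w x * (f x)\<^sup>2 * 1"
      using w_pos[OF x] by (intro mult_left_mono p_row_le) auto
    finally show "(\<Sum>y\<in>R. w x * p x y * (f x)\<^sup>2) \<le> w x * (f x)\<^sup>2" by simp
  qed
  moreover have "killed_form f = (\<Sum>x\<in>R. w x * (f x)\<^sup>2) - ?c"
    unfolding killed_form_def
    by (simp add: power2_eq_square algebra_simps sum_subtractf sum_distrib_left)
  ultimately show ?thesis by linarith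
qed

lemma generator_stopped_killed:
  assumes "\<And>y. y \<notin> R \<Longrightarrow> f y = 0" "x \<in> R"
  shows "generator (stopped_kernel R p) f x = (\<Sum>y\<in>R. p x y * f y) - f x"
proof -
  have "(\<Sum>y\<in>UNIV. p x y * f y) = (\<Sum>y\<in>R. p x y * f y)"
    using assms by (intro sum.mono_neutral_right) auto
  moreover have "(\<Sum>y\<in>UNIV. p x y * f x) = f x"
    using kernel by (simp add: stochastic_kernel_def flip: sum_distrib_right)
  ultimately show ?thesis
    using assms(2) unfolding generator_stopped by (simp add: generator_def right_diff_distrib sum_subtractf)
qed

section \<open>Splitting the survival function along h\<close>

definition \<phi> :: real where "\<phi> = 1 - l"

text \<open>\<open>h\<close> is determined on \<open>R\<close> only. Its extension by 0 is an
  eigenfunction of the stopped generator on the whole space.\<close>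

definition h0 :: "'a \<Rightarrow> real" where "h0 x = indicator R x * h x"

definition B :: real where "B = (\<Sum>x\<in>R. w x * (h x)\<^sup>2)"

lemma phi_pos: "0 < \<phi>" using l_less_1 by (simp add: \<phi>_def)

lemma generator_h0: "generator (stopped_kernel R p) h0 = (\<lambda>x. - \<phi> * h0 x)"
proof
  fix x
  show "generator (stopped_kernel R p) h0 x = - \<phi> * h0 x"
  proof (cases "x \<in> R")
    case True
    have "(\<Sum>y\<in>R. p x y * h0 y) = (\<Sum>y\<in>R. p x y * h y)" by (simp add: h0_def)
    then show ?thesis
      using True by (subst generator_stopped_killed) (auto simp: h0_def h_eigen \<phi>_def algebra_simps)
  qed (simp add: generator_stopped h0_def)
qed

lemma heat_h0: "heat (stopped_kernel R p) t h0 x = exp (- \<phi> * t) * h0 x"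
proof -
  have G: "generator (stopped_kernel R p) (\<lambda>x. c * h0 x) = (\<lambda>x. c * (- \<phi> * h0 x))" for c
    using generator_sum[where p = "stopped_kernel R p" and I = "{()}" and c = "\<lambda>_. c" and f = "\<lambda>_. h0"]
    by (simp add: generator_h0)
  have pow: "(generator (stopped_kernel R p) ^^ n) h0 = (\<lambda>x. (- \<phi>) ^ n * h0 x)" for n
  proof (induction n)
    case (Suc n)
    show ?case unfolding funpow.simps o_apply Suc G by (simp add: mult_ac)
  qed simp
  have "heat (stopped_kernel R p) t h0 x = (\<Sum>n. (- \<phi> * t) ^ n / fact n * h0 x)"
    unfolding heat_def pow power_mult_distrib by (simp add: mult_ac)
  also have "\<dots> = exp (- \<phi> * t) * h0 x"
    by (subst suminf_mult2[OF summable_exp_real, symmetric]) (simp only: suminf_exp_real)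
  finally show ?thesis .
qed

text \<open>The part of the constant 1 on \<open>R\<close> orthogonal to \<open>h\<close>: the
  projection coefficient is \<open>1 / B\<close> because \<open>h\<close> has mean 1.\<close>

definition g0 :: "'a \<Rightarrow> real" where "g0 x = indicator R x - h0 x / B"

definition g :: "real \<Rightarrow> 'a \<Rightarrow> real" where "g t = heat (stopped_kernel R p) t g0"

lemma B_pos: "0 < B"
  unfolding B_def using R_nonempty by (intro sum_pos mult_pos_pos zero_less_power w_pos h_pos) auto

text \<open>The summand is \<open>w x * (1 - h x / B)\<^sup>2\<close> expanded. This squared norm of
  \<open>g0\<close> serves both as initial value of the decay and as a Cauchy-Schwarz
  factor.\<close>

lemma sum_defect: "(\<Sum>x\<in>R. w x - 2 / B * (w x * h x) + 1 / B\<^sup>2 * (w x * (h x)\<^sup>2)) = 1 - 1 / B"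
proof -
  have "(\<Sum>x\<in>R. w x - 2 / B * (w x * h x) + 1 / B\<^sup>2 * (w x * (h x)\<^sup>2)) = 1 - 2 / B * 1 + 1 / B\<^sup>2 * B"
    unfolding sum.distrib sum_subtractf sum_distrib_left[symmetric] w_sum h_sum B_def[symmetric] ..
  also have "\<dots> = 1 - 1 / B" using B_pos by (simp add: power2_eq_square field_simps)
  finally show ?thesis .
qed

lemma survival_decomposition: "survival R p t x = exp (- \<phi> * t) * h0 x / B + g t x"
proof -
  have "indicator R = (\<lambda>x. (1 / B) * h0 x + 1 * g0 x)" by (auto simp: g0_def)
  then show ?thesis
    unfolding survival_def g_def
    using heat_lincomb[OF stochastic_stopped_kernel[OF kernel], of R t "1 / B" h0 1 g0 x]
    by (simp add: heat_h0)
qed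

lemma g_outside: "x \<notin> R \<Longrightarrow> g t x = 0"
  by (simp add: g_def heat_stopped_outside g0_def h0_def)

lemma g_DERIV:
  assumes "x \<in> R"
  shows "((\<lambda>t. g t x) has_real_derivative ((\<Sum>y\<in>R. p x y * g t y) - g t x)) (at t)"
proof -
  have "generator (stopped_kernel R p) (g t) x = (\<Sum>y\<in>R. p x y * g t y) - g t x"
    using assms by (intro generator_stopped_killed g_outside)
  then show ?thesis
    using heat_DERIV[OF stochastic_stopped_kernel[OF kernel], of R g0 x t] by (simp add: g_def)
qed

lemma g0_orthogonal: "(\<Sum>x\<in>R. w x * h x * g0 x) = 0"
proof -
  have "(\<Sum>x\<in>R. w x * h x * g0 x) = (\<Sum>x\<in>R. w x * h x) - (\<Sum>x\<in>R. w x * (h x)\<^sup>2) / B"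
    by (simp add: g0_def h0_def sum_divide_distrib power2_eq_square right_diff_distrib mult_ac
        flip: sum_subtractf)
  then show ?thesis using B_pos by (simp add: h_sum flip: B_def)
qed

text \<open>By self-adjointness the scalar product with \<open>h\<close> solves a linear equation
  with rate \<open>- \<phi>\<close>, and it starts at 0.\<close>

lemma g_orthogonal: "(\<Sum>x\<in>R. w x * h x * g t x) = 0"
proof -
  define F where "F t = exp (\<phi> * t) * (\<Sum>x\<in>R. w x * h x * g t x)" for t
  have "(F has_real_derivative 0) (at t)" for t
  proof -
    have "(\<Sum>x\<in>R. w x * h x * ((\<Sum>y\<in>R. p x y * g t y) - g t x))
        = (\<Sum>x\<in>R. \<Sum>y\<in>R. of_real (w x * p x y) * (h x * g t y)) - (\<Sum>x\<in>R. w x * h x * g t x)"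
      by (simp add: right_diff_distrib sum_subtractf sum_distrib_left mult_ac)
    also have "(\<Sum>x\<in>R. \<Sum>y\<in>R. of_real (w x * p x y) * (h x * g t y))
        = (\<Sum>x\<in>R. \<Sum>y\<in>R. of_real (w x * p x y) * (h y * g t x))"
      by (rule sum_swap_sym)
    also have "\<dots> = (\<Sum>x\<in>R. w x * g t x * (\<Sum>y\<in>R. p x y * h y))"
      by (simp add: sum_distrib_left mult_ac)
    also have "\<dots> = l * (\<Sum>x\<in>R. w x * h x * g t x)"
      by (simp add: h_eigen sum_distrib_left mult_ac)
    finally have e: "(\<Sum>x\<in>R. w x * h x * ((\<Sum>y\<in>R. p x y * g t y) - g t x))
        = - \<phi> * (\<Sum>x\<in>R. w x * h x * g t x)" by (simp add: \<phi>_def algebra_simps)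
    have "(F has_real_derivative
        exp (\<phi> * t) * \<phi> * (\<Sum>x\<in>R. w x * h x * g t x)
        + (\<Sum>x\<in>R. w x * h x * ((\<Sum>y\<in>R. p x y * g t y) - g t x)) * exp (\<phi> * t)) (at t)"
      unfolding F_def by (rule DERIV_mult DERIV_sum DERIV_cmult g_DERIV | assumption
          | (rule derivative_eq_intros, simp_all))+
    then show ?thesis unfolding e by simp
  qed
  then have "F t = F 0" by (intro DERIV_isconst_all) simp
  also have "F 0 = 0" using g0_orthogonal by (simp add: F_def g_def heat_0)
  finally show ?thesis by (simp add: F_def)
qed

end

text \<open>Only the inequality satisfied by the gap enters the estimates; that it holds for the
  infimum itself is checked in the final proof.\<close>

locale gapped_chain = killed_chain +
  fixes \<gamma> :: real
  assumes gap_pos: "0 < \<gamma>" and gap: "\<gamma> * Var f \<le> Dir f"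
begin

definition \<epsilon> :: real where "\<epsilon> = \<phi> / \<gamma>"

lemma eps_pos: "0 < \<epsilon>" using phi_pos gap_pos by (simp add: \<epsilon>_def)

text \<open>Test the gap on \<open>h\<close>: its variance is \<open>B - 1\<close>, and its
  Dirichlet form is at most the killed form, which equals \<open>\<phi> * B\<close>.\<close>

lemma one_minus_inverse_B_le: "1 - 1 / B \<le> \<epsilon>"
proof -
  have "killed_form h = (\<Sum>x\<in>R. \<phi> * (w x * (h x)\<^sup>2))"
    unfolding killed_form_def
    by (intro sum.cong refl) (simp add: h_eigen \<phi>_def power2_eq_square algebra_simps)
  then have "killed_form h = \<phi> * B" by (simp add: B_def sum_distrib_left)
  moreover have "Var h = B - 1" by (simp add: Var_eq B_def h_sum)
  ultimately have "\<gamma> * (B - 1) \<le> \<phi> * B" using gap[of h] Dir_le_killed_form[of h] by simp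
  then show ?thesis using gap_pos B_pos by (simp add: \<epsilon>_def field_simps)
qed

text \<open>For \<open>f\<close> orthogonal to \<open>h\<close>, the mean of \<open>f\<close> is its
  scalar product with \<open>1 - h / B\<close>. Cauchy-Schwarz then leaves at least the fraction
  \<open>1 - \<epsilon>\<close> of the squared norm in the variance.\<close>

lemma killed_gap:
  assumes orth: "(\<Sum>x\<in>R. w x * h x * f x) = 0"
  shows "\<gamma> * (1 - \<epsilon>) * (\<Sum>x\<in>R. w x * (f x)\<^sup>2) \<le> killed_form f"
proof -
  let ?N = "\<Sum>x\<in>R. w x * (f x)\<^sup>2"
  have N0: "?N \<ge> 0" using w_pos by (intro sum_nonneg) (auto simp: less_imp_le)
  have "(\<Sum>x\<in>R. w x * f x) = (\<Sum>x\<in>R. w x * f x) - (\<Sum>x\<in>R. w x * h x * f x) / B"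
    by (simp add: orth)
  also have "\<dots> = (\<Sum>x\<in>R. (sqrt (w x) * f x) * (sqrt (w x) * (1 - h x / B)))"
    unfolding sum_divide_distrib sum_subtractf[symmetric]
  proof (intro sum.cong refl)
    fix x assume "x \<in> R"
    then have e: "sqrt (w x) * sqrt (w x) = w x" using w_pos[of x] by simp
    have "(sqrt (w x) * f x) * (sqrt (w x) * (1 - h x / B)) = (sqrt (w x) * sqrt (w x)) * (f x * (1 - h x / B))"
      by (simp only: ac_simps)
    then show "w x * f x - w x * h x * f x / B = (sqrt (w x) * f x) * (sqrt (w x) * (1 - h x / B))"
      unfolding e by (simp add: algebra_simps)
  qed
  finally have "(\<Sum>x\<in>R. w x * f x)\<^sup>2
      \<le> (\<Sum>x\<in>R. (sqrt (w x) * f x)\<^sup>2) * (\<Sum>x\<in>R. (sqrt (w x) * (1 - h x / B))\<^sup>2)"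
    by (simp only: Cauchy_Schwarz_ineq_sum)
  also have "(\<Sum>x\<in>R. (sqrt (w x) * f x)\<^sup>2) = ?N"
    using w_pos by (intro sum.cong refl) (simp add: power_mult_distrib less_imp_le)
  also have "(\<Sum>x\<in>R. (sqrt (w x) * (1 - h x / B))\<^sup>2)
      = (\<Sum>x\<in>R. w x - 2 / B * (w x * h x) + 1 / B\<^sup>2 * (w x * (h x)\<^sup>2))"
    using w_pos by (intro sum.cong refl)
      (simp add: power_mult_distrib less_imp_le power2_diff power_divide algebra_simps)
  also have "\<dots> = 1 - 1 / B" by (rule sum_defect)
  finally have "(\<Sum>x\<in>R. w x * f x)\<^sup>2 \<le> ?N * (1 - 1 / B)" .
  also have "\<dots> \<le> ?N * \<epsilon>" using one_minus_inverse_B_le N0 by (rule mult_left_mono)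
  finally have "(1 - \<epsilon>) * ?N \<le> Var f" by (simp add: Var_eq algebra_simps)
  then have "\<gamma> * ((1 - \<epsilon>) * ?N) \<le> \<gamma> * Var f" using gap_pos by (intro mult_left_mono) auto
  then show ?thesis using gap[of f] Dir_le_killed_form[of f] by (simp add: mult.assoc)
qed

text \<open>The derivative of the squared norm is \<open>-2 * killed_form (g s)\<close>, so
  \<open>killed_gap\<close> makes the rescaled norm \<open>F\<close> nonincreasing.\<close>

lemma g_decay:
  assumes t: "0 \<le> t"
  shows "(\<Sum>x\<in>R. w x * (g t x)\<^sup>2) \<le> exp (- 2 * (\<gamma> * (1 - \<epsilon>)) * t) * \<epsilon>"
proof -
  define a where "a = \<gamma> * (1 - \<epsilon>)"
  define N where "N t = (\<Sum>x\<in>R. w x * (g t x)\<^sup>2)" for t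
  define F where "F t = exp (2 * a * t) * N t" for t
  have "F t \<le> F 0"
  proof (rule DERIV_nonpos_imp_nonincreasing[OF t])
    fix s :: real
    have "(N has_real_derivative (\<Sum>x\<in>R. w x * (2 * g s x * ((\<Sum>y\<in>R. p x y * g s y) - g s x)))) (at s)"
      unfolding N_def
      by (intro DERIV_sum DERIV_cmult) (auto intro!: derivative_eq_intros g_DERIV)
    moreover have "(\<Sum>x\<in>R. w x * (2 * g s x * ((\<Sum>y\<in>R. p x y * g s y) - g s x))) = - 2 * killed_form (g s)"
      unfolding killed_form_def sum_distrib_left
      by (intro sum.cong refl) (simp add: algebra_simps)
    ultimately have "(N has_real_derivative - 2 * killed_form (g s)) (at s)" by simp
    then have "(F has_real_derivative exp (2 * a * s) * (2 * (a * N s - killed_form (g s)))) (at s)"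
      unfolding F_def by (auto intro!: derivative_eq_intros simp: algebra_simps)
    moreover have "exp (2 * a * s) * (2 * (a * N s - killed_form (g s))) \<le> 0"
      using killed_gap[OF g_orthogonal, of s] by (simp add: mult_nonneg_nonpos a_def N_def)
    ultimately show "\<exists>y. (F has_real_derivative y) (at s) \<and> y \<le> 0" by blast
  qed
  also have "F 0 = (\<Sum>x\<in>R. w x - 2 / B * (w x * h x) + 1 / B\<^sup>2 * (w x * (h x)\<^sup>2))"
    unfolding F_def N_def g_def heat_0 g0_def h0_def
    by (simp add: power2_diff power_divide algebra_simps)
  also have "\<dots> = 1 - 1 / B" by (rule sum_defect)
  also have "\<dots> \<le> \<epsilon>" by (rule one_minus_inverse_B_le)
  finally have "exp (- 2 * a * t) * (exp (2 * a * t) * N t) \<le> exp (- 2 * a * t) * \<epsilon>"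
    unfolding F_def by (intro mult_left_mono) auto
  then show ?thesis by (simp add: a_def N_def mult_exp_exp flip: mult.assoc)
qed

section \<open>Pointwise estimates from time T on\<close>

definition \<zeta> :: real where "\<zeta> = Min ((\<lambda>x. w x * (h x)\<^sup>2) ` R)"

lemma zeta_le: "x \<in> R \<Longrightarrow> \<zeta> \<le> w x * (h x)\<^sup>2"
  unfolding \<zeta>_def by (intro Min_le) auto

lemma zeta_pos: "0 < \<zeta>"
  unfolding \<zeta>_def using R_nonempty
  by (subst Min_gr_iff) (auto intro!: mult_pos_pos zero_less_power w_pos h_pos)

definition T :: real where
  "T = 1 / \<gamma> * ln (2 / (\<epsilon> * (1 - \<epsilon>) * \<zeta>)) * (1 + sqrt (\<epsilon> / (1 - \<epsilon>))) * ((1 - \<epsilon>) / (1 - 3 * \<epsilon>))"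

context
  assumes eps: "\<epsilon> < 1 / 3"
begin

lemma B_le: "B \<le> 1 / (1 - \<epsilon>)"
  using one_minus_inverse_B_le B_pos eps by (simp add: field_simps)

text \<open>\<open>B\<close> is a sum of at least two terms, each at least \<open>\<zeta>\<close>,
  and \<open>B < 2\<close>.\<close>

lemma zeta_less_1: "\<zeta> < 1"
proof -
  have "2 * \<zeta> \<le> real (card R) * \<zeta>" using two_states zeta_pos by (intro mult_right_mono) auto
  also have "\<dots> \<le> B" unfolding B_def using sum_bounded_below[of R \<zeta> "\<lambda>x. w x * (h x)\<^sup>2"] zeta_le by simp
  also have "\<dots> \<le> 1 / (1 - \<epsilon>)" by (rule B_le)
  also have "\<dots> < 2" using eps by (simp add: field_simps)
  finally show ?thesis by simp
qed

lemma log_pos: "0 < ln (2 / (\<epsilon> * (1 - \<epsilon>) * \<zeta>))"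
proof (subst ln_gt_zero_iff)
  have "\<epsilon> * (1 - \<epsilon>) * \<zeta> \<le> 1"
    using eps eps_pos zeta_pos zeta_less_1 by (intro mult_le_one) auto
  moreover have "0 < \<epsilon> * (1 - \<epsilon>) * \<zeta>"
    using eps eps_pos zeta_pos by (intro mult_pos_pos) auto
  ultimately show "1 < 2 / (\<epsilon> * (1 - \<epsilon>) * \<zeta>)" "0 < 2 / (\<epsilon> * (1 - \<epsilon>) * \<zeta>)"
    by (auto simp: less_divide_eq)
qed

lemma T_pos: "0 < T"
  unfolding T_def using gap_pos log_pos eps eps_pos
  by (intro mult_pos_pos divide_pos_pos add_pos_nonneg) auto

text \<open>The bound \<open>\<gamma> (1 - 2 \<epsilon>)\<close> on the gap of the killed chain is better than the one
  that the definition of \<open>T\<close> is tailored to: \<open>(1 - 2 \<epsilon>) (1 - \<epsilon>) \<ge> 1 - 3 \<epsilon>\<close>.\<close>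

lemma exp_T_le: "exp (- (\<gamma> * (1 - 2 * \<epsilon>)) * T) \<le> \<epsilon> * (1 - \<epsilon>) * \<zeta> / 2"
proof -
  define L where "L = ln (2 / (\<epsilon> * (1 - \<epsilon>) * \<zeta>))"
  define r where "r = 1 + sqrt (\<epsilon> / (1 - \<epsilon>))"
  have r: "r \<ge> 1" using eps eps_pos by (simp add: r_def)
  have "\<gamma> * (1 - 2 * \<epsilon>) * T = L * (r * ((1 - 2 * \<epsilon>) * (1 - \<epsilon>) / (1 - 3 * \<epsilon>)))"
    unfolding T_def L_def[symmetric] r_def[symmetric] using gap_pos by simp
  moreover have "(1 - 2 * \<epsilon>) * (1 - \<epsilon>) / (1 - 3 * \<epsilon>) \<ge> 1"
    using eps by (simp add: le_divide_eq algebra_simps)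
  with r have "1 * 1 \<le> r * ((1 - 2 * \<epsilon>) * (1 - \<epsilon>) / (1 - 3 * \<epsilon>))" by (intro mult_mono) auto
  with log_pos have "L * 1 \<le> L * (r * ((1 - 2 * \<epsilon>) * (1 - \<epsilon>) / (1 - 3 * \<epsilon>)))"
    by (intro mult_left_mono) (auto simp: L_def)
  ultimately have "exp (- (\<gamma> * (1 - 2 * \<epsilon>)) * T) \<le> exp (- L)" by simp
  also have "exp (- L) = \<epsilon> * (1 - \<epsilon>) * \<zeta> / 2"
    using eps eps_pos zeta_pos by (simp add: L_def exp_minus)
  finally show ?thesis .
qed

text \<open>The squared norm of \<open>g t\<close> dominates each
  \<open>w x * (g t x)\<^sup>2\<close>. Using \<open>\<zeta> \<le> w x * (h x)\<^sup>2\<close> to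
  replace the weight gives an error relative to \<open>h x\<close>, uniform in
  \<open>x\<close>.\<close>

lemma survival_after_T:
  assumes t: "T \<le> t" and x: "x \<in> R"
  shows "\<bar>exp (\<phi> * t) * survival R p t x - h x / B\<bar> \<le> \<epsilon> / 3 * (h x / B)"
proof -
  define b where "b = \<gamma> * (1 - 2 * \<epsilon>)"
  have t0: "0 \<le> t" using t T_pos by simp
  have hx: "0 < h x" by (rule h_pos[OF x])
  have B: "0 < B" by (rule B_pos)
  have "\<gamma> * (1 - \<epsilon>) = b + \<phi>" using gap_pos by (simp add: b_def \<epsilon>_def field_simps)
  note decay = g_decay[OF t0, unfolded this]
  have "w x * (g t x)\<^sup>2 \<le> (\<Sum>x\<in>R. w x * (g t x)\<^sup>2)"
    using x w_pos by (intro member_le_sum) (auto simp: less_imp_le)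
  with decay have 1: "w x * (g t x)\<^sup>2 \<le> exp (- 2 * (b + \<phi>) * t) * \<epsilon>" by linarith
  have "\<zeta> * (exp (\<phi> * t) * g t x)\<^sup>2 \<le> (w x * (h x)\<^sup>2) * (exp (\<phi> * t) * g t x)\<^sup>2"
    using zeta_le[OF x] by (intro mult_right_mono) auto
  also have "\<dots> = (h x)\<^sup>2 * exp (2 * \<phi> * t) * (w x * (g t x)\<^sup>2)"
    by (simp add: power_mult_distrib mult_ac flip: exp_double)
  also have "\<dots> \<le> (h x)\<^sup>2 * exp (2 * \<phi> * t) * (exp (- 2 * (b + \<phi>) * t) * \<epsilon>)"
    using 1 by (intro mult_left_mono) auto
  also have "\<dots> = (h x)\<^sup>2 * \<epsilon> * (exp (2 * \<phi> * t) * exp (- 2 * (b + \<phi>) * t))" by simp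
  \<comment> \<open>Compensating the factor \<open>exp (\<phi> * t)\<close> costs
    \<open>\<phi> = \<gamma> * \<epsilon>\<close> of the decay rate, which leaves
    \<open>b\<close>.\<close>
  also have "exp (2 * \<phi> * t) * exp (- 2 * (b + \<phi>) * t) = (exp (- b * t))\<^sup>2"
    by (simp add: mult_exp_exp algebra_simps flip: exp_double)
  also have "(h x)\<^sup>2 * \<epsilon> * (exp (- b * t))\<^sup>2 \<le> (h x)\<^sup>2 * \<epsilon> * (\<epsilon> * (1 - \<epsilon>) * \<zeta> / 2)\<^sup>2"
  proof (intro mult_left_mono power_mono)
    have "exp (- b * t) \<le> exp (- b * T)"
      using t gap_pos eps by (simp add: b_def)
    then show "exp (- b * t) \<le> \<epsilon> * (1 - \<epsilon>) * \<zeta> / 2"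
      using exp_T_le unfolding b_def by (rule order_trans)
  qed (use eps_pos in auto)
  also have "\<dots> = \<zeta> * ((h x)\<^sup>2 * \<epsilon> * \<epsilon>\<^sup>2 * (1 - \<epsilon>)\<^sup>2 * \<zeta> / 4)"
    by (simp add: power2_eq_square)
  finally have "(exp (\<phi> * t) * g t x)\<^sup>2 \<le> (h x)\<^sup>2 * \<epsilon> * \<epsilon>\<^sup>2 * (1 - \<epsilon>)\<^sup>2 * \<zeta> / 4"
    using zeta_pos by simp
  also have "\<dots> = (\<epsilon> * \<zeta>) * ((h x)\<^sup>2 * \<epsilon>\<^sup>2 * (1 - \<epsilon>)\<^sup>2 / 4)" by simp
  \<comment> \<open>One of the two factors \<open>\<zeta>\<close> from \<open>exp_T_le\<close> paid
    for the passage to a point. The other one, with a spare \<open>\<epsilon>\<close>, gives the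
    relative error \<open>\<epsilon> / 3\<close>: the bound \<open>4 / 9\<close> is what turns
    \<open>1 / 4\<close> into the square of \<open>1 / 3\<close>.\<close>
  also have "\<dots> \<le> (4 / 9) * ((h x)\<^sup>2 * \<epsilon>\<^sup>2 * (1 - \<epsilon>)\<^sup>2 / 4)"
  proof (intro mult_right_mono)
    have "\<epsilon> * \<zeta> \<le> (1 / 3) * 1"
      using eps zeta_less_1 zeta_pos eps_pos by (intro mult_mono) auto
    then show "\<epsilon> * \<zeta> \<le> 4 / 9" by simp
  qed auto
  also have "\<dots> = (\<epsilon> / 3 * (h x * (1 - \<epsilon>)))\<^sup>2"
    by (simp add: power_mult_distrib power_divide)
  finally have "\<bar>exp (\<phi> * t) * g t x\<bar>\<^sup>2 \<le> (\<epsilon> / 3 * (h x * (1 - \<epsilon>)))\<^sup>2"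
    unfolding power2_abs .
  then have "\<bar>exp (\<phi> * t) * g t x\<bar> \<le> \<epsilon> / 3 * (h x * (1 - \<epsilon>))"
    by (rule power2_le_imp_le) (use eps eps_pos hx in auto)
  also have "\<dots> \<le> \<epsilon> / 3 * (h x / B)"
  proof (intro mult_left_mono)
    have "1 - \<epsilon> \<le> 1 / B" using one_minus_inverse_B_le by simp
    then have "h x * (1 - \<epsilon>) \<le> h x * (1 / B)" using hx by (intro mult_left_mono) auto
    then show "h x * (1 - \<epsilon>) \<le> h x / B" by simp
  qed (use eps_pos in auto)
  also have "exp (\<phi> * t) * g t x = exp (\<phi> * t) * survival R p t x - h x / B"
  proof -
    have "exp (\<phi> * t) * survival R p t x = exp (\<phi> * t) * exp (- \<phi> * t) * h x / B + exp (\<phi> * t) * g t x"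
      unfolding survival_decomposition using x by (simp add: h0_def algebra_simps)
    then show ?thesis by (simp add: mult_exp_exp)
  qed
  finally show ?thesis .
qed

text \<open>The rescaled survival probabilities \<open>P\<close> at \<open>T\<close> and
  \<open>Q\<close> at \<open>t\<close> both lie within the factors \<open>1 - \<epsilon> / 3\<close>
  and \<open>1 + \<epsilon> / 3\<close> of the same \<open>A\<close>. Their ratio is then between
  \<open>1 - \<epsilon>\<close> and \<open>1 + \<epsilon>\<close>, the upper bound using
  \<open>\<epsilon> * \<epsilon> \<le> \<epsilon>\<close>.\<close>

lemma mean_survival_after_T:
  assumes t: "T \<le> t" and n: "\<And>x. x \<in> R \<Longrightarrow> 0 \<le> n x"
  defines "S \<equiv> \<lambda>t. \<Sum>x\<in>R. n x * survival R p t x"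
  shows "S T * exp (\<phi> * T - \<phi> * t) * (1 - \<epsilon>) \<le> S t"
    and "S t \<le> S T * exp (\<phi> * T - \<phi> * t) * (1 + \<epsilon>)"
proof -
  define A where "A = (\<Sum>x\<in>R. n x * (h x / B))"
  have A: "A \<ge> 0" unfolding A_def using n h_pos B_pos by (intro sum_nonneg) (auto simp: less_imp_le)
  have S: "exp (\<phi> * s) * S s \<le> (1 + \<epsilon> / 3) * A \<and> (1 - \<epsilon> / 3) * A \<le> exp (\<phi> * s) * S s" if s: "T \<le> s" for s
  proof -
    have "\<bar>exp (\<phi> * s) * S s - A\<bar> = \<bar>\<Sum>x\<in>R. n x * (exp (\<phi> * s) * survival R p s x - h x / B)\<bar>"
      by (simp add: S_def A_def right_diff_distrib sum_subtractf sum_distrib_left mult_ac)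
    also have "\<dots> \<le> (\<Sum>x\<in>R. n x * (\<epsilon> / 3 * (h x / B)))"
    proof (rule order_trans[OF sum_abs], rule sum_mono)
      fix x assume x: "x \<in> R"
      show "\<bar>n x * (exp (\<phi> * s) * survival R p s x - h x / B)\<bar> \<le> n x * (\<epsilon> / 3 * (h x / B))"
        unfolding abs_mult using n[OF x] survival_after_T[OF s x] by (intro mult_mono) auto
    qed
    also have "\<dots> = \<epsilon> / 3 * A" by (simp add: A_def sum_distrib_left mult_ac)
    finally have "\<bar>exp (\<phi> * s) * S s - A\<bar> \<le> \<epsilon> / 3 * A" .
    then show ?thesis unfolding distrib_right left_diff_distrib mult_1 by linarith
  qed
  define P where "P = exp (\<phi> * T) * S T"
  define Q where "Q = exp (\<phi> * t) * S t"
  have P: "P \<le> (1 + \<epsilon> / 3) * A" "(1 - \<epsilon> / 3) * A \<le> P" using S[of T] by (simp_all add: P_def)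
  have Q: "Q \<le> (1 + \<epsilon> / 3) * A" "(1 - \<epsilon> / 3) * A \<le> Q" using S[OF t] by (simp_all add: Q_def)
  have e3: "\<epsilon> * \<epsilon> \<le> \<epsilon>" using eps eps_pos by (intro mult_left_le) auto
  have PT: "exp (- \<phi> * t) * P = S T * exp (\<phi> * T - \<phi> * t)"
    by (simp add: P_def exp_diff exp_minus field_simps)
  have QT: "exp (- \<phi> * t) * Q = S t"
    by (simp add: Q_def mult_exp_exp flip: mult.assoc)
  have "P * (1 - \<epsilon>) \<le> (1 + \<epsilon> / 3) * A * (1 - \<epsilon>)" using P eps by (intro mult_right_mono) auto
  also have "\<dots> = ((1 + \<epsilon> / 3) * (1 - \<epsilon>)) * A" by simp
  also have "\<dots> \<le> (1 - \<epsilon> / 3) * A" using A eps_pos by (intro mult_right_mono) (auto simp: algebra_simps)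
  also have "\<dots> \<le> Q" by (rule Q)
  finally have "exp (- \<phi> * t) * (P * (1 - \<epsilon>)) \<le> exp (- \<phi> * t) * Q" by (intro mult_left_mono) auto
  then show "S T * exp (\<phi> * T - \<phi> * t) * (1 - \<epsilon>) \<le> S t"
    unfolding QT by (simp only: mult.assoc[symmetric] PT)
  have "Q \<le> (1 + \<epsilon> / 3) * A" by (rule Q)
  also have "\<dots> \<le> ((1 - \<epsilon> / 3) * (1 + \<epsilon>)) * A"
    using A e3 by (intro mult_right_mono) (auto simp: field_simps)
  also have "\<dots> = (1 - \<epsilon> / 3) * A * (1 + \<epsilon>)" by simp
  also have "\<dots> \<le> P * (1 + \<epsilon>)" using P eps_pos by (intro mult_right_mono) auto
  finally have "exp (- \<phi> * t) * Q \<le> exp (- \<phi> * t) * (P * (1 + \<epsilon>))" by (intro mult_left_mono) auto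
  then show "S t \<le> S T * exp (\<phi> * T - \<phi> * t) * (1 + \<epsilon>)"
    unfolding QT by (simp only: mult.assoc[symmetric] PT)
qed

end

end

section \<open>Exponential exit times\<close>

text \<open>Detailed balance carries positivity of the measure along every edge.\<close>

lemma pmf_reversible_pos:
  fixes p :: "'a::finite \<Rightarrow> 'a \<Rightarrow> real"
  assumes irr: "irreducible_on UNIV p" and rev: "reversible_wrt p \<mu>"
  shows "0 < pmf \<mu> y"
proof -
  obtain x where "x \<in> set_pmf \<mu>" using set_pmf_not_empty[of \<mu>] by blast
  then have x: "0 < pmf \<mu> x" by (simp add: pmf_positive)
  have "(x, y) \<in> {(u, v). u \<in> UNIV \<and> v \<in> UNIV \<and> 0 < p u v}\<^sup>*"
    using irr by (simp add: irreducible_on_def)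
  then show ?thesis
  proof (induction rule: rtrancl_induct)
    case (step u v)
    then have "0 < pmf \<mu> u * p u v" by simp
    also have "\<dots> = pmf \<mu> v * p v u" using rev by (simp add: reversible_wrt_def)
    finally show ?case by (metis less_eq_real_def mult_zero_left pmf_nonneg)
  qed (rule x)
qed

lemma exit_transition:
  assumes irr: "irreducible_on UNIV p" and "x \<in> R" "y \<notin> R"
  shows "\<exists>u\<in>R. \<exists>v. v \<notin> R \<and> 0 < p u v"
proof -
  have "(x, y) \<in> {(u, v). u \<in> UNIV \<and> v \<in> UNIV \<and> 0 < p u v}\<^sup>*"
    using irr by (simp add: irreducible_on_def)
  then have "y \<notin> R \<longrightarrow> (\<exists>u\<in>R. \<exists>v. v \<notin> R \<and> 0 < p u v)"
    by (induction rule: rtrancl_induct) (use assms in auto)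
  then show ?thesis using assms by simp
qed

text \<open>The two kernels differ only in their loops, which do not affect reachability.\<close>

lemma irreducible_on_restricted:
  assumes "irreducible_on R (restricted_kernel R p)"
  shows "irreducible_on R p"
proof -
  let ?r = "{(u, v). u \<in> R \<and> v \<in> R \<and> 0 < p u v}"
  have "{(u, v). u \<in> R \<and> v \<in> R \<and> 0 < restricted_kernel R p u v} \<subseteq> ?r\<^sup>="
    by (auto simp: restricted_kernel_def split: if_splits)
  from rtrancl_mono[OF this] have "{(u, v). u \<in> R \<and> v \<in> R \<and> 0 < restricted_kernel R p u v}\<^sup>* \<subseteq> ?r\<^sup>*"
    by simp
  then show ?thesis using assms unfolding irreducible_on_def by blast
qed

lemma variance_cond_pmf:
  fixes \<mu> :: "'a::finite pmf"
  assumes "set_pmf \<mu> \<inter> R \<noteq> {}"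
  shows "measure_pmf.variance (cond_pmf \<mu> R) f
    = (\<Sum>x\<in>R. pmf (cond_pmf \<mu> R) x * (f x - (\<Sum>y\<in>R. pmf (cond_pmf \<mu> R) y * f y))\<^sup>2)"
proof -
  have E: "measure_pmf.expectation (cond_pmf \<mu> R) g = (\<Sum>x\<in>R. pmf (cond_pmf \<mu> R) x * g x)" for g :: "'a \<Rightarrow> real"
    using assms by (subst integral_measure_pmf_real[where A = R]) (auto simp: mult.commute)
  show ?thesis unfolding E ..
qed

theorem theorem2p6:
  fixes p :: "'a::finite \<Rightarrow> 'a \<Rightarrow> real"
    and \<mu> \<nu> :: "'a pmf"
    and R :: "'a set"
    and M :: "'w measure"
    and X :: "real \<Rightarrow> 'w \<Rightarrow> 'a"
    and t :: real
  assumes "stochastic_kernel p"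
    and "irreducible_on UNIV p"
    and "reversible_wrt p \<mu>"
    and "R \<noteq> UNIV" and "card R \<ge> 2"
    and "irreducible_on R (restricted_kernel R p)"
    and "irreducible_on (- R) (restricted_kernel (- R) p)"
    and "set_pmf \<nu> \<subseteq> R"
    and "markov_process M X p \<nu>"
    and "eps_star R p \<mu> < 1 / 3"
    and "t \<ge> phi_star R p * T_star R p \<mu>"
  shows "(1 - exit_prob M X R p \<mu>) * exp (- t) *
           (exp (phi_star R p * T_star R p \<mu>) * (1 - eps_star R p \<mu>))
         \<le> \<P>(\<omega> in M. hitting_time X (- R) \<omega> > ereal (t / phi_star R p))
       \<and> \<P>(\<omega> in M. hitting_time X (- R) \<omega> > ereal (t / phi_star R p))
         \<le> (1 - exit_prob M X R p \<mu>) * exp (- t) *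
           (exp (phi_star R p * T_star R p \<mu>) * (1 + eps_star R p \<mu>))"
proof -
  define w where "w = pmf (cond_pmf \<mu> R)"
  define \<gamma> where "\<gamma> = spectral_gap R p \<mu>"
  have \<mu>: "0 < pmf \<mu> x" for x by (rule pmf_reversible_pos[OF assms(2,3)])
  obtain x0 where x0: "x0 \<in> R" using assms(5) by fastforce
  have "x0 \<in> set_pmf \<mu>" using \<mu>[of x0] by (simp add: set_pmf_iff)
  then have ne: "set_pmf \<mu> \<inter> R \<noteq> {}" using x0 by blast
  have \<mu>R: "0 < measure_pmf.prob \<mu> R"
    using \<mu>[of x0] x0 by (intro measure_pmf_posI[of x0]) (auto simp: set_pmf_iff)
  have w: "w x = pmf \<mu> x / measure_pmf.prob \<mu> R" if "x \<in> R" for x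
    using that by (simp add: w_def pmf_cond[OF ne])
  interpret killed_chain p R w
  proof
    show "stochastic_kernel p" by fact
    show "0 < w x" if "x \<in> R" for x using \<mu> \<mu>R by (simp add: w[OF that])
    show "(\<Sum>x\<in>R. w x) = 1"
      unfolding w_def using ne by (intro sum_pmf_eq_1) auto
    show "w x * p x y = w y * p y x" if "x \<in> R" "y \<in> R" for x y
      using assms(3) by (simp add: w[OF that(1)] w[OF that(2)] reversible_wrt_def)
    show "irreducible_on R p" by (rule irreducible_on_restricted) fact
    show "\<exists>x\<in>R. \<exists>z. z \<notin> R \<and> 0 < p x z"
      using exit_transition[OF assms(2) x0] assms(4) by auto
    show "2 \<le> card R" by fact
  qed
  have D: "dirichlet_form R p \<mu> f = Dir f" for f
    unfolding dirichlet_form_def Dir_def w_def[symmetric]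
    by (intro arg_cong[where f = "\<lambda>s. 1 / 2 * s"] sum.cong refl) (auto simp: restricted_kernel_def)
  have V: "measure_pmf.variance (cond_pmf \<mu> R) f = Var f" for f
    unfolding variance_cond_pmf[OF ne] Var_def w_def[symmetric] ..
  let ?Q = "{Dir f / Var f | f. Var f \<noteq> 0}"
  have \<gamma>: "\<gamma> = Inf ?Q" by (simp add: \<gamma>_def spectral_gap_def D V)
  have Var_nonneg: "0 \<le> Var f" for f
    unfolding Var_def using w_pos by (intro sum_nonneg) (auto simp: less_imp_le)
  obtain K where K: "K > 0" "\<And>f. Var f \<le> K * Dir f" using poincare_inequality by auto
  have Q_ne: "?Q \<noteq> {}"
  proof -
    \<comment> \<open>Stated for a general \<open>g\<close> so that one computation gives the first
      and the second moment of the indicator; its variance is positive because \<open>R\<close> has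
      a second state.\<close>
    have i: "(\<Sum>x\<in>R. w x * g (indicator {x0} x)) = w x0" if "g 0 = 0" "g 1 = 1" for g :: "real \<Rightarrow> real"
    proof -
      have "(\<Sum>x\<in>R. w x * g (indicator {x0} x)) = (\<Sum>x\<in>{x0}. w x * g (indicator {x0} x))"
        using x0 that by (intro sum.mono_neutral_right) auto
      then show ?thesis using that by simp
    qed
    have "Var (indicator {x0}) = w x0 - (w x0)\<^sup>2"
      unfolding Var_eq using i[of "\<lambda>z. z\<^sup>2"] i[of "\<lambda>z. z"] by simp
    moreover have "w x0 < (\<Sum>x\<in>R. w x)"
    proof -
      have "R \<noteq> {x0}" using two_states by auto
      then obtain y where "y \<in> R" "y \<noteq> x0" using x0 by auto
      then have "(\<Sum>x\<in>{x0}. w x) < (\<Sum>x\<in>R. w x)"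
        using x0 w_pos by (intro sum_strict_mono2[of _ _ y]) (auto simp: less_imp_le)
      then show ?thesis by simp
    qed
    ultimately have "Var (indicator {x0}) \<noteq> 0"
      using w_pos[OF x0] by (simp add: w_sum power2_eq_square)
    then show ?thesis by blast
  qed
  interpret gapped_chain p R w \<gamma>
  proof
    have "1 / K \<le> \<gamma>"
      unfolding \<gamma>
    proof (rule cInf_greatest[OF Q_ne])
      fix q assume "q \<in> ?Q"
      then obtain f where f: "q = Dir f / Var f" "Var f \<noteq> 0" by auto
      then have "0 < Var f" using Var_nonneg[of f] by simp
      then show "1 / K \<le> q" unfolding f(1) using K(2)[of f] K(1) by (simp add: field_simps)
    qed
    then show "0 < \<gamma>" using K(1) by (meson less_le_trans zero_less_divide_1_iff)
    show "\<gamma> * Var f \<le> Dir f" for f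
    proof (cases "Var f = 0")
      case False
      have "bdd_below ?Q" by (rule bdd_belowI[of _ 0]) (auto simp: Dir_nonneg Var_nonneg)
      then have "\<gamma> \<le> Dir f / Var f" unfolding \<gamma> using False by (intro cInf_lower) auto
      then show ?thesis using False Var_nonneg[of f] by (simp add: field_simps)
    qed (simp add: Dir_nonneg)
  qed
  have phi: "phi_star R p = \<phi>" by (simp add: phi_star_eq \<phi>_def)
  have eps: "eps_star R p \<mu> = \<epsilon>" by (simp add: eps_star_def \<epsilon>_def phi flip: \<gamma>_def)
  have "pmf (cond_pmf \<mu> R) x * (h_star R p \<mu> x)\<^sup>2 = w x * (h x)\<^sup>2" if "x \<in> R" for x
    using w_pos[OF that] that by (simp add: h_star_def pmf_quasi_stationary flip: w_def)
  then have zeta: "zeta_star R p \<mu> = \<zeta>"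
    unfolding zeta_star_def \<zeta>_def by (intro arg_cong[where f = Min] image_cong) auto
  have T: "T_star R p \<mu> = T"
    by (simp add: T_star_def T_star_delta_def T_def eps zeta flip: \<gamma>_def)
  have e3: "\<epsilon> < 1 / 3" using assms(10) by (simp add: eps)
  \<comment> \<open>\<open>s\<close> is the time of the process itself; in this scale the hypothesis
    on \<open>t\<close> reads \<open>T \<le> s\<close>.\<close>
  define s where "s = t / \<phi>"
  have t: "t = \<phi> * s" using phi_pos by (simp add: s_def)
  have s: "T \<le> s" using assms(11) phi_pos by (simp add: phi T t)
  have exit: "1 - exit_prob M X R p \<mu> = (\<Sum>x\<in>R. pmf \<nu> x * survival R p T x)"
    unfolding exit_prob_def T by (rule hitting_time_less[OF assms(1,9) T_pos[OF e3]])
  have surv: "\<P>(\<omega> in M. hitting_time X (- R) \<omega> > ereal (t / \<phi>))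
      = (\<Sum>x\<in>R. pmf \<nu> x * survival R p s x)"
    unfolding s_def[symmetric]
    by (rule hitting_time_greater(2)[OF assms(1,9)]) (use s T_pos[OF e3] in simp)
  have e: "c * exp (- t) * (exp (\<phi> * T) * d) = c * exp (\<phi> * T - \<phi> * s) * d" for c d :: real
    by (simp add: t exp_diff exp_minus field_simps)
  then show ?thesis
    using mean_survival_after_T[OF e3 s, of "pmf \<nu>"]
    unfolding exit phi eps T surv e by simp
qed

end
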